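(* Let $\mathbf{B}=(B,\nu,\beta)$ be a system, $n\in\mathbb{N}$, and let $A=B\odot M_n$ with faithful normal trace $\mu=\nu\odot\mathrm{tr}$, where $M_n=M_n(\mathbb{C})$ and $\mathrm{tr}$ is the normalized trace on $M_n$. Let $\alpha$ be a $*$-automorphism of $A$ such that $\alpha(b\otimes1)=\beta(b)\otimes1$ for all $b\in B$. Let $\mathbf{A}=(A,\mu,\alpha)$ and let $\mathbf{F}=(F,\lambda,\varphi)$ be the subsystem given by $F=B\otimes1$, $\lambda(b\otimes1)=\nu(b)$ and $\varphi(b\otimes1)=\beta(b)\otimes1$ (so that $\mathbf{A}$ is a finite extension of $\mathbf{F}$). Then $\mathbf{A}$ has discrete spectrum relative to $\mathbf{F}$.
   Context: $B\odot M_n$ is the algebraic tensor product, i.e. the von Neumann algebra of $n\times n$ matrices over $B$. Inner products are linear in the second variable. A system $\mathbf{A}=(A,\mu,\alpha)$ consists of a von Neumann algebra $A$, a faithful normal trace $\mu$ on $A$ (a positive linear functional on $A$, so $A$ is finite), and a $*$-automorphism $\alpha$ of $A$ with $\mu\circ\alpha=\mu$. $A$ is taken to act (via its GNS representation for $\mu$) on a Hilbert space $H$ with a cyclic and separating vector $\Omega$ such that $\mu(a)=\langle\Omega,a\Omega\rangle$ for all $a\in A$. $U$ is the unitary on $H$ determined by $Ua\Omega=\alpha(a)\Omega$ for $a\in A$. A system $\mathbf{F}=(F,\lambda,\varphi)$ is a subsystem of $\mathbf{A}$ if $F$ is a von Neumann subalgebra of $A$ containing the unit of $A$, $\mu|_F=\lambda$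 and $\alpha|_F=\varphi$. Put $H_F:=\overline{F\Omega}$ and let $e_F$ be the orthogonal projection of $H$ onto $H_F$. Let $J$ be the modular conjugation (the antiunitary extending $a\Omega\mapsto a^*\Omega$, $a\in A$) and $j(a):=Ja^*J$. The basic construction $\langle A,e_F\rangle$ is the von Neumann algebra on $H$ generated by $A$ and $e_F$; it carries the canonical faithful normal semifinite tracial weight $\bar\mu:\langle A,e_F\rangle^+\to[0,\infty]$ determined by $\bar\mu(ae_Fb)=\mu(ab)$ for $a,b\in A$ (extended linearly to $\operatorname{span}\{ae_Fb:a,b\in A\}$). $H$ is a right $A$-module by $xa:=j(a)x$. A closed subspace $V\subset H$ is a right-$F$-submodule if $xa\in V$ for all $x\in V$, $a\in F$ (equivalently, its orthogonal projection $P_V$ lies in $\langle A,e_F\rangle$), and is $U$-invariant if $UV=V$. A $U$-$\bar\mu$-module is a $U$-invariant right-$F$-submodule $V\subset H\ominus H_F$ with $\bar\mu(P_V)<\infty$. $\mathcal{E}_{A/F}$ is the closed subspace of $H\ominus H_F$ spanned by all $U$-$\bar\mu$-modules. $\mathbf{A}$ has discrete spectrum relative to $\mathbf{F}$ if $\mathcal{E}_{A/F}=H\ominus H_F$. *)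

theory Defs
  imports "HOL-Analysis.Analysis"
begin

section \<open>Complex Hilbert spaces\<close>

class scaleC =
  fixes scaleC :: "complex \<Rightarrow> 'a \<Rightarrow> 'a"  (infixr \<open>*\<^sub>C\<close> 75)

class complex_hilbert_space = banach + scaleC +
  fixes cinner :: "'a \<Rightarrow> 'a \<Rightarrow> complex"
  assumes scaleC_add_right: "c *\<^sub>C (x + y) = c *\<^sub>C x + c *\<^sub>C y"
    and scaleC_add_left: "(c + d) *\<^sub>C x = c *\<^sub>C x + d *\<^sub>C x"
    and scaleC_scaleC: "c *\<^sub>C d *\<^sub>C x = (c * d) *\<^sub>C x"
    and scaleR_scaleC: "r *\<^sub>R x = complex_of_real r *\<^sub>C x"
    and cinner_commute: "cinner x y = cnj (cinner y x)"
    and cinner_add_right: "cinner x (y + z) = cinner x y + cinner x z"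
    and cinner_scaleC_right: "cinner x (c *\<^sub>C y) = c * cinner x y"
    and cinner_norm: "cinner x x = complex_of_real ((norm x)\<^sup>2)"

lemma cinner_add_left: "cinner (x + y) z = cinner x z + cinner y z"
  for x y z :: "'a::complex_hilbert_space"
  by (metis cinner_add_right cinner_commute complex_cnj_add)

lemma cinner_scaleC_left: "cinner (c *\<^sub>C x) y = cnj c * cinner x y"
  for x y :: "'a::complex_hilbert_space"
  by (metis cinner_commute cinner_scaleC_right complex_cnj_mult)

lemma norm_scaleC: "norm (c *\<^sub>C x) = cmod c * norm x"
  for x :: "'a::complex_hilbert_space"
proof -
  have "complex_of_real ((norm (c *\<^sub>C x))\<^sup>2) = (c * cnj c) * complex_of_real ((norm x)\<^sup>2)"
    by (simp only: cinner_norm[symmetric] cinner_scaleC_left cinner_scaleC_right)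
      (simp add: mult_ac)
  also have "\<dots> = complex_of_real ((cmod c * norm x)\<^sup>2)"
    by (simp only: complex_norm_square[symmetric] power_mult_distrib of_real_mult)
  finally have "(norm (c *\<^sub>C x))\<^sup>2 = (cmod c * norm x)\<^sup>2"
    by (simp only: of_real_eq_iff)
  then show ?thesis
    by (simp add: power2_eq_iff_nonneg)
qed

lemma bounded_linear_scaleC: "bounded_linear (\<lambda>x. c *\<^sub>C x :: 'a::complex_hilbert_space)"
proof (rule bounded_linear_intro[where K = "cmod c"])
  fix r and x :: 'a
  show "c *\<^sub>C r *\<^sub>R x = r *\<^sub>R c *\<^sub>C x"
    by (simp add: scaleR_scaleC scaleC_scaleC mult.commute)
qed (simp_all add: scaleC_add_right norm_scaleC mult.commute)

instantiation complex :: complex_hilbert_space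
begin

definition scaleC_complex :: "complex \<Rightarrow> complex \<Rightarrow> complex"
  where "scaleC_complex c x = c * x"

definition cinner_complex :: "complex \<Rightarrow> complex \<Rightarrow> complex"
  where "cinner_complex x y = cnj x * y"

instance
  by standard
    (auto simp: scaleC_complex_def cinner_complex_def algebra_simps scaleR_conv_of_real
      complex_norm_square[symmetric])

end

instantiation vec :: (scaleC, finite) scaleC
begin

definition scaleC_vec :: "complex \<Rightarrow> 'a ^ 'b \<Rightarrow> 'a ^ 'b"
  where "scaleC_vec c x = (\<chi> i. c *\<^sub>C (x $ i))"

instance ..

end

instantiation vec :: (complex_hilbert_space, finite) complex_hilbert_space
begin

definition cinner_vec :: "'a ^ 'b \<Rightarrow> 'a ^ 'b \<Rightarrow> complex"
  where "cinner_vec x y = (\<Sum>i\<in>UNIV. cinner (x $ i) (y $ i))"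

instance
proof
  fix x y z :: "'a ^ 'b" and c d :: complex and r :: real
  show "c *\<^sub>C (x + y) = c *\<^sub>C x + c *\<^sub>C y"
    by (simp add: vec_eq_iff scaleC_vec_def scaleC_add_right)
  show "(c + d) *\<^sub>C x = c *\<^sub>C x + d *\<^sub>C x"
    by (simp add: vec_eq_iff scaleC_vec_def scaleC_add_left)
  show "c *\<^sub>C d *\<^sub>C x = (c * d) *\<^sub>C x"
    by (simp add: vec_eq_iff scaleC_vec_def scaleC_scaleC)
  show "r *\<^sub>R x = complex_of_real r *\<^sub>C x"
    by (simp add: vec_eq_iff scaleC_vec_def scaleR_scaleC)
  show "cinner x y = cnj (cinner y x)"
    unfolding cinner_vec_def cnj_sum by (rule sum.cong[OF refl]) (rule cinner_commute)
  show "cinner x (y + z) = cinner x y + cinner x z"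
    by (simp add: cinner_vec_def cinner_add_right sum.distrib)
  show "cinner x (c *\<^sub>C y) = c * cinner x y"
    by (simp add: cinner_vec_def scaleC_vec_def cinner_scaleC_right sum_distrib_left)
  show "cinner x x = complex_of_real ((norm x)\<^sup>2)"
    by (simp add: cinner_vec_def norm_vec_def L2_set_def cinner_norm sum_nonneg)
qed

end

definition csubspace :: "'a::{ab_group_add, scaleC} set \<Rightarrow> bool"
  where "csubspace V \<longleftrightarrow> 0 \<in> V \<and> (\<forall>x\<in>V. \<forall>y\<in>V. x + y \<in> V) \<and> (\<forall>c. \<forall>x\<in>V. c *\<^sub>C x \<in> V)"

definition clinear_on :: "'a::{plus, scaleC} set \<Rightarrow> ('a \<Rightarrow> 'b::{plus, scaleC}) \<Rightarrow> bool"
  where "clinear_on V f \<longleftrightarrow>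
    (\<forall>x\<in>V. \<forall>y\<in>V. f (x + y) = f x + f y) \<and> (\<forall>c. \<forall>x\<in>V. f (c *\<^sub>C x) = c *\<^sub>C f x)"

definition ocompl :: "'a::complex_hilbert_space set \<Rightarrow> 'a set"
  where "ocompl V = {x. \<forall>v\<in>V. cinner v x = 0}"


section \<open>Operators and von Neumann algebras\<close>

text \<open>The library type \<open>'a \<Rightarrow>\<^sub>L 'a\<close> consists of the bounded \<^emph>\<open>real\<close>-linear maps;
  \<open>bounded_ops\<close> is the algebra of bounded complex-linear operators.\<close>

definition bounded_ops :: "('a::complex_hilbert_space \<Rightarrow>\<^sub>L 'a) set"
  where "bounded_ops = {T :: 'a \<Rightarrow>\<^sub>L 'a. \<forall>c x. T (c *\<^sub>C x) = c *\<^sub>C T x}"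

instantiation blinfun :: (real_normed_vector, complex_hilbert_space) scaleC
begin

lift_definition scaleC_blinfun :: "complex \<Rightarrow> ('a \<Rightarrow>\<^sub>L 'b) \<Rightarrow> ('a \<Rightarrow>\<^sub>L 'b)"
  is "\<lambda>c T x. c *\<^sub>C T x"
  by (rule bounded_linear_compose[OF bounded_linear_scaleC])

instance ..

end

definition adj :: "('a::complex_hilbert_space \<Rightarrow>\<^sub>L 'a) \<Rightarrow> ('a \<Rightarrow>\<^sub>L 'a)"
  where "adj T = (THE S :: 'a \<Rightarrow>\<^sub>L 'a. \<forall>x y. cinner (S x) y = cinner x (T y))"

definition proj :: "'a::complex_hilbert_space set \<Rightarrow> ('a \<Rightarrow>\<^sub>L 'a)"
  where "proj V = (THE P :: 'a \<Rightarrow>\<^sub>L 'a. \<forall>x. P x \<in> V \<and> x - P x \<in> ocompl V)"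

definition unitary_op :: "('a::complex_hilbert_space \<Rightarrow>\<^sub>L 'a) \<Rightarrow> bool"
  where "unitary_op U \<longleftrightarrow>
    U \<in> bounded_ops \<and> adj U o\<^sub>L U = id_blinfun \<and> U o\<^sub>L adj U = id_blinfun"

definition antiunitary :: "('a::complex_hilbert_space \<Rightarrow> 'a) \<Rightarrow> bool"
  where "antiunitary J \<longleftrightarrow> (\<forall>x y. J (x + y) = J x + J y) \<and> (\<forall>c x. J (c *\<^sub>C x) = cnj c *\<^sub>C J x) \<and>
    (\<forall>x y. cinner (J x) (J y) = cinner y x) \<and> surj J"

definition positive_op :: "('a::complex_hilbert_space \<Rightarrow>\<^sub>L 'a) \<Rightarrow> bool"
  where "positive_op T \<longleftrightarrow> (\<forall>x. cinner x (T x) \<in> \<real>\<^sub>\<ge>\<^sub>0)"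

definition op_le :: "('a::complex_hilbert_space \<Rightarrow>\<^sub>L 'a) \<Rightarrow> ('a \<Rightarrow>\<^sub>L 'a) \<Rightarrow> bool"
  where "op_le S T \<longleftrightarrow> positive_op (T - S)"

definition commutant :: "('a::complex_hilbert_space \<Rightarrow>\<^sub>L 'a) set \<Rightarrow> ('a \<Rightarrow>\<^sub>L 'a) set"
  where "commutant S = {T \<in> bounded_ops. \<forall>s\<in>S. T o\<^sub>L s = s o\<^sub>L T}"

definition von_neumann_algebra :: "('a::complex_hilbert_space \<Rightarrow>\<^sub>L 'a) set \<Rightarrow> bool"
  where "von_neumann_algebra M \<longleftrightarrow>
    M \<subseteq> bounded_ops \<and> (\<forall>a\<in>M. adj a \<in> M) \<and> commutant (commutant M) = M"

definition pos_part :: "('a::complex_hilbert_space \<Rightarrow>\<^sub>L 'a) set \<Rightarrow> ('a \<Rightarrow>\<^sub>L 'a) set"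
  where "pos_part M = {x \<in> M. positive_op x}"

definition star_hom_on ::
    "('a::complex_hilbert_space \<Rightarrow>\<^sub>L 'a) set \<Rightarrow> (('a \<Rightarrow>\<^sub>L 'a) \<Rightarrow> ('b::complex_hilbert_space \<Rightarrow>\<^sub>L 'b)) \<Rightarrow> bool"
  where "star_hom_on M \<pi> \<longleftrightarrow> clinear_on M \<pi> \<and> (\<forall>a\<in>M. \<forall>b\<in>M. \<pi> (a o\<^sub>L b) = \<pi> a o\<^sub>L \<pi> b) \<and>
    (\<forall>a\<in>M. \<pi> (adj a) = adj (\<pi> a))"

definition star_automorphism ::
    "('a::complex_hilbert_space \<Rightarrow>\<^sub>L 'a) set \<Rightarrow> (('a \<Rightarrow>\<^sub>L 'a) \<Rightarrow> ('a \<Rightarrow>\<^sub>L 'a)) \<Rightarrow> bool"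
  where "star_automorphism M \<alpha> \<longleftrightarrow> star_hom_on M \<alpha> \<and> bij_betw \<alpha> M M"


section \<open>Traces, weights and systems\<close>

text \<open>Normality is preservation of suprema of bounded upward directed sets of positive elements,
  where the supremum \<open>x\<close> is taken in the ordered set of self-adjoint elements of \<open>M\<close>
  (an upper bound of a nonempty set of positive operators is automatically positive).\<close>

definition normal_on ::
    "('a::complex_hilbert_space \<Rightarrow>\<^sub>L 'a) set \<Rightarrow> (('a \<Rightarrow>\<^sub>L 'a) \<Rightarrow> ennreal) \<Rightarrow> bool"
  where "normal_on M w \<longleftrightarrow>
    (\<forall>D x. D \<subseteq> pos_part M \<longrightarrow> D \<noteq> {} \<longrightarrow> (\<forall>a\<in>D. \<forall>b\<in>D. \<exists>c\<in>D. op_le a c \<and> op_le b c) \<longrightarrow>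
      x \<in> pos_part M \<longrightarrow> (\<forall>d\<in>D. op_le d x) \<longrightarrow>
      (\<forall>y\<in>pos_part M. (\<forall>d\<in>D. op_le d y) \<longrightarrow> op_le x y) \<longrightarrow>
      w x = (SUP d\<in>D. w d))"

definition faithful_normal_trace ::
    "('a::complex_hilbert_space \<Rightarrow>\<^sub>L 'a) set \<Rightarrow> (('a \<Rightarrow>\<^sub>L 'a) \<Rightarrow> complex) \<Rightarrow> bool"
  where "faithful_normal_trace M \<tau> \<longleftrightarrow>
    clinear_on M \<tau> \<and>
    (\<forall>x\<in>pos_part M. \<tau> x \<in> \<real>\<^sub>\<ge>\<^sub>0) \<and>
    (\<forall>a\<in>M. \<forall>b\<in>M. \<tau> (a o\<^sub>L b) = \<tau> (b o\<^sub>L a)) \<and>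
    (\<forall>x\<in>pos_part M. \<tau> x = 0 \<longrightarrow> x = 0) \<and>
    normal_on M (\<lambda>x. ennreal (Re (\<tau> x)))"

definition faithful_normal_semifinite_tracial_weight ::
    "('a::complex_hilbert_space \<Rightarrow>\<^sub>L 'a) set \<Rightarrow> (('a \<Rightarrow>\<^sub>L 'a) \<Rightarrow> ennreal) \<Rightarrow> bool"
  where "faithful_normal_semifinite_tracial_weight M w \<longleftrightarrow>
    (\<forall>x\<in>pos_part M. \<forall>y\<in>pos_part M. w (x + y) = w x + w y) \<and>
    (\<forall>r\<ge>0. \<forall>x\<in>pos_part M. w (r *\<^sub>R x) = ennreal r * w x) \<and>
    (\<forall>x\<in>pos_part M. w x = 0 \<longrightarrow> x = 0) \<and>
    normal_on M w \<and>
    (\<forall>x\<in>pos_part M. x \<noteq> 0 \<longrightarrow> (\<exists>y\<in>pos_part M. y \<noteq> 0 \<and> op_le y x \<and> w y < \<infinity>)) \<and>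
    (\<forall>x\<in>M. w (adj x o\<^sub>L x) = w (x o\<^sub>L adj x))"

record (overloaded) 'a sys =
  alg :: "('a \<Rightarrow>\<^sub>L 'a) set"
  tr :: "('a \<Rightarrow>\<^sub>L 'a) \<Rightarrow> complex"
  dyn :: "('a \<Rightarrow>\<^sub>L 'a) \<Rightarrow> ('a \<Rightarrow>\<^sub>L 'a)"

definition is_system :: "'a::complex_hilbert_space sys \<Rightarrow> bool"
  where "is_system S \<longleftrightarrow>
    von_neumann_algebra (alg S) \<and> faithful_normal_trace (alg S) (tr S) \<and>
    star_automorphism (alg S) (dyn S) \<and> (\<forall>a\<in>alg S. tr S (dyn S a) = tr S a)"

text \<open>The cyclic representation \<open>\<pi>\<close> with \<open>\<mu>(a) = \<langle>\<Omega>, \<pi>(a)\<Omega>\<rangle>\<close>. It is unique up to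
  unitary equivalence, and below the algebra \<open>A\<close> acting on \<open>H\<close> is \<open>\<pi> ` A\<close>.\<close>

definition gns_representation ::
    "'a::complex_hilbert_space sys \<Rightarrow> (('a \<Rightarrow>\<^sub>L 'a) \<Rightarrow> ('h::complex_hilbert_space \<Rightarrow>\<^sub>L 'h)) \<Rightarrow> 'h \<Rightarrow> bool"
  where "gns_representation S \<pi> \<Omega> \<longleftrightarrow>
    star_hom_on (alg S) \<pi> \<and> \<pi> ` alg S \<subseteq> bounded_ops \<and>
    closure ((\<lambda>a. \<pi> a \<Omega>) ` alg S) = UNIV \<and>
    (\<forall>a\<in>alg S. \<pi> a \<Omega> = 0 \<longrightarrow> \<pi> a = 0) \<and>
    (\<forall>a\<in>alg S. tr S a = cinner \<Omega> (\<pi> a \<Omega>))"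

definition evolution ::
    "'a::complex_hilbert_space sys \<Rightarrow> (('a \<Rightarrow>\<^sub>L 'a) \<Rightarrow> ('h::complex_hilbert_space \<Rightarrow>\<^sub>L 'h)) \<Rightarrow> 'h \<Rightarrow> ('h \<Rightarrow>\<^sub>L 'h)"
  where "evolution S \<pi> \<Omega> =
    (THE U :: 'h \<Rightarrow>\<^sub>L 'h. unitary_op U \<and> (\<forall>a\<in>alg S. U (\<pi> a \<Omega>) = \<pi> (dyn S a) \<Omega>))"


section \<open>The basic construction\<close>

text \<open>From here on \<open>M\<close> and \<open>N\<close> are the algebras \<open>A\<close> and \<open>F\<close> as they act on \<open>H\<close>.\<close>

definition cyclic_space :: "('h::complex_hilbert_space \<Rightarrow>\<^sub>L 'h) set \<Rightarrow> 'h \<Rightarrow> 'h set"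
  where "cyclic_space N \<Omega> = closure ((\<lambda>a :: 'h \<Rightarrow>\<^sub>L 'h. a \<Omega>) ` N)"

definition jones_projection :: "('h::complex_hilbert_space \<Rightarrow>\<^sub>L 'h) set \<Rightarrow> 'h \<Rightarrow> ('h \<Rightarrow>\<^sub>L 'h)"
  where "jones_projection N \<Omega> = proj (cyclic_space N \<Omega>)"

definition modular_conj :: "('h::complex_hilbert_space \<Rightarrow>\<^sub>L 'h) set \<Rightarrow> 'h \<Rightarrow> 'h \<Rightarrow> 'h"
  where "modular_conj M \<Omega> = (THE J. antiunitary J \<and> (\<forall>a\<in>M. J (blinfun_apply a \<Omega>) = adj a \<Omega>))"

definition right_act :: "('h::complex_hilbert_space \<Rightarrow>\<^sub>L 'h) set \<Rightarrow> 'h \<Rightarrow> 'h \<Rightarrow> ('h \<Rightarrow>\<^sub>L 'h) \<Rightarrow> 'h"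
  where "right_act M \<Omega> x a = modular_conj M \<Omega> (adj a (modular_conj M \<Omega> x))"

definition basic_construction ::
    "('h::complex_hilbert_space \<Rightarrow>\<^sub>L 'h) set \<Rightarrow> ('h \<Rightarrow>\<^sub>L 'h) set \<Rightarrow> 'h \<Rightarrow> ('h \<Rightarrow>\<^sub>L 'h) set"
  where "basic_construction M N \<Omega> = von_neumann_algebra hull (insert (jones_projection N \<Omega>) M)"

text \<open>The condition \<open>w(a e b) = \<mu>(ab)\<close>, extended linearly to the span of the \<open>a e b\<close>, is imposed
  on the positive elements of that span, where the weight itself is defined. By polarization
  this is equivalent to the identity for the linear extension of \<open>w\<close>.\<close>

definition canonical_trace ::
    "('h::complex_hilbert_space \<Rightarrow>\<^sub>L 'h) set \<Rightarrow> ('h \<Rightarrow>\<^sub>L 'h) set \<Rightarrow> 'h \<Rightarrow> (('h \<Rightarrow>\<^sub>L 'h) \<Rightarrow> ennreal) \<Rightarrow> bool"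
  where "canonical_trace M N \<Omega> w \<longleftrightarrow>
    faithful_normal_semifinite_tracial_weight (basic_construction M N \<Omega>) w \<and>
    (\<forall>(k::nat) (a :: nat \<Rightarrow> 'h \<Rightarrow>\<^sub>L 'h) (b :: nat \<Rightarrow> 'h \<Rightarrow>\<^sub>L 'h). (\<forall>i<k. a i \<in> M \<and> b i \<in> M) \<longrightarrow>
      positive_op (\<Sum>i<k. a i o\<^sub>L jones_projection N \<Omega> o\<^sub>L b i) \<longrightarrow>
      w (\<Sum>i<k. a i o\<^sub>L jones_projection N \<Omega> o\<^sub>L b i) < \<infinity> \<and>
      complex_of_real (enn2real (w (\<Sum>i<k. a i o\<^sub>L jones_projection N \<Omega> o\<^sub>L b i)))
        = (\<Sum>i<k. cinner \<Omega> ((a i o\<^sub>L b i) \<Omega>)))"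


section \<open>Relative discrete spectrum\<close>

definition right_submodule ::
    "('h::complex_hilbert_space \<Rightarrow>\<^sub>L 'h) set \<Rightarrow> ('h \<Rightarrow>\<^sub>L 'h) set \<Rightarrow> 'h \<Rightarrow> 'h set \<Rightarrow> bool"
  where "right_submodule M N \<Omega> V \<longleftrightarrow>
    csubspace V \<and> closed V \<and> (\<forall>x\<in>V. \<forall>a\<in>N. right_act M \<Omega> x a \<in> V)"

definition finite_module ::
    "('h::complex_hilbert_space \<Rightarrow>\<^sub>L 'h) set \<Rightarrow> ('h \<Rightarrow>\<^sub>L 'h) set \<Rightarrow> 'h \<Rightarrow> ('h \<Rightarrow>\<^sub>L 'h) \<Rightarrow>
      (('h \<Rightarrow>\<^sub>L 'h) \<Rightarrow> ennreal) \<Rightarrow> 'h set \<Rightarrow> bool"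
  where "finite_module M N \<Omega> U w V \<longleftrightarrow>
    right_submodule M N \<Omega> V \<and> U ` V = V \<and> V \<subseteq> ocompl (cyclic_space N \<Omega>) \<and> w (proj V) < \<infinity>"

definition discrete_part ::
    "('h::complex_hilbert_space \<Rightarrow>\<^sub>L 'h) set \<Rightarrow> ('h \<Rightarrow>\<^sub>L 'h) set \<Rightarrow> 'h \<Rightarrow> ('h \<Rightarrow>\<^sub>L 'h) \<Rightarrow>
      (('h \<Rightarrow>\<^sub>L 'h) \<Rightarrow> ennreal) \<Rightarrow> 'h set"
  where "discrete_part M N \<Omega> U w =
    (\<lambda>V. csubspace V \<and> closed V) hull \<Union> {V. finite_module M N \<Omega> U w V}"

text \<open>Discrete spectrum of \<open>A\<close> relative to \<open>F\<close>, for a given GNS representation \<open>(\<pi>, \<Omega>)\<close> of \<open>A\<close> and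
  the canonical trace \<open>w\<close> of the basic construction.\<close>

definition relative_discrete_spectrum ::
    "'a::complex_hilbert_space sys \<Rightarrow> 'a sys \<Rightarrow> (('a \<Rightarrow>\<^sub>L 'a) \<Rightarrow> ('h::complex_hilbert_space \<Rightarrow>\<^sub>L 'h)) \<Rightarrow> 'h \<Rightarrow>
      (('h \<Rightarrow>\<^sub>L 'h) \<Rightarrow> ennreal) \<Rightarrow> bool"
  where "relative_discrete_spectrum A F \<pi> \<Omega> w \<longleftrightarrow>
    discrete_part (\<pi> ` alg A) (\<pi> ` alg F) \<Omega> (evolution A \<pi> \<Omega>) w
      = ocompl (cyclic_space (\<pi> ` alg F) \<Omega>)"


section \<open>Matrices over an operator algebra\<close>

text \<open>For \<open>b\<close> acting on \<open>K\<close>, the elementary tensor \<open>b \<otimes> m\<close> acts on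
  \<open>K \<otimes> \<complex>\<^sup>n = K\<^sup>n\<close> as the operator matrix with \<open>(i, j)\<close> entry \<open>m\<^sub>i\<^sub>j b\<close>.\<close>

lift_definition tensor_op ::
    "('k::complex_hilbert_space \<Rightarrow>\<^sub>L 'k) \<Rightarrow> complex ^ 'n ^ 'n \<Rightarrow> (('k ^ 'n) \<Rightarrow>\<^sub>L ('k ^ 'n))"
  is "\<lambda>b m v. \<chi> i. \<Sum>j\<in>UNIV. (m $ i $ j) *\<^sub>C b (v $ j)"
proof -
  fix b :: "'k \<Rightarrow> 'k" and m :: "complex ^ 'n ^ 'n"
  assume b: "bounded_linear b"
  have comp: "bounded_linear (\<lambda>v :: 'k ^ 'n. \<Sum>j\<in>UNIV. (m $ i $ j) *\<^sub>C b (v $ j))" for i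
    by (intro bounded_linear_sum bounded_linear_compose[OF bounded_linear_scaleC]
        bounded_linear_compose[OF b] bounded_linear_vec_nth)
  define K where "K i = onorm (\<lambda>v :: 'k ^ 'n. \<Sum>j\<in>UNIV. (m $ i $ j) *\<^sub>C b (v $ j))" for i
  have K: "norm (\<Sum>j\<in>UNIV. (m $ i $ j) *\<^sub>C b (v $ j)) \<le> norm v * K i" for i and v :: "'k ^ 'n"
    unfolding K_def using onorm[OF comp, of i v] by (simp add: mult.commute)
  show "bounded_linear (\<lambda>v. \<chi> i. \<Sum>j\<in>UNIV. (m $ i $ j) *\<^sub>C b (v $ j))"
  proof (rule bounded_linear_intro[where K = "\<Sum>i\<in>UNIV. K i"])
    fix v :: "'k ^ 'n"
    have "norm (\<chi> i. \<Sum>j\<in>UNIV. (m $ i $ j) *\<^sub>C b (v $ j))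
        \<le> (\<Sum>i\<in>UNIV. norm (\<Sum>j\<in>UNIV. (m $ i $ j) *\<^sub>C b (v $ j)))"
      unfolding norm_vec_def by (rule order_trans[OF L2_set_le_sum]) auto
    also have "\<dots> \<le> norm v * (\<Sum>i\<in>UNIV. K i)"
      unfolding sum_distrib_left by (intro sum_mono K)
    finally show "norm (\<chi> i. \<Sum>j\<in>UNIV. (m $ i $ j) *\<^sub>C b (v $ j)) \<le> norm v * (\<Sum>i\<in>UNIV. K i)" .
  next
    fix v w :: "'k ^ 'n" and r :: real
    show "(\<chi> i. \<Sum>j\<in>UNIV. (m $ i $ j) *\<^sub>C b ((v + w) $ j)) =
        (\<chi> i. \<Sum>j\<in>UNIV. (m $ i $ j) *\<^sub>C b (v $ j)) + (\<chi> i. \<Sum>j\<in>UNIV. (m $ i $ j) *\<^sub>C b (w $ j))"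
      unfolding vec_eq_iff using linear_add[OF bounded_linear.linear[OF comp]] by simp
    show "(\<chi> i. \<Sum>j\<in>UNIV. (m $ i $ j) *\<^sub>C b ((r *\<^sub>R v) $ j)) =
        r *\<^sub>R (\<chi> i. \<Sum>j\<in>UNIV. (m $ i $ j) *\<^sub>C b (v $ j))"
      unfolding vec_eq_iff using linear_scale[OF bounded_linear.linear[OF comp]] by simp
  qed
qed

definition matrix_algebra ::
    "('k::complex_hilbert_space \<Rightarrow>\<^sub>L 'k) set \<Rightarrow> (('k ^ 'n) \<Rightarrow>\<^sub>L ('k ^ 'n)) set"
  where "matrix_algebra B = csubspace hull {tensor_op b m | b m. b \<in> B}"

end

theory Submission
  imports Defs
begin

text \<open>Put \<open>V = H \<ominus> H\<^sub>F\<close>. The point is that \<open>V\<close> is itself a \<open>U\<close>-\<open>\<mu>bar\<close>-module. It is \<open>U\<close>-invariant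
  because \<open>\<alpha>\<close> maps \<open>F\<close> onto \<open>F\<close>, and \<open>U\<close> exists because \<open>\<alpha>\<close> preserves the trace: every trace on
  \<open>B \<otimes> M\<^sub>n\<close>, in particular \<open>\<mu> \<circ> \<alpha>\<close>, is determined by its restriction to \<open>B \<otimes> 1\<close>. It has finite
  trace because the matrix units \<open>u\<^sub>i\<^sub>j = 1 \<otimes> e\<^sub>i\<^sub>j\<close> satisfy \<open>1 = \<Sum>\<^sub>i\<^sub>j n u\<^sub>i\<^sub>j e\<^sub>F u\<^sub>j\<^sub>i\<close>, so that the
  identity lies in the span of \<open>A e\<^sub>F A\<close> and \<open>\<mu>bar(P\<^sub>V) \<le> \<mu>bar(1) = n\<^sup>2\<close>.\<close>

text \<open>Two obstacles shape the proof. \<open>proj\<close>, \<open>adj\<close>,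
  \<open>evolution\<close> and \<open>modular_conj\<close> are definite descriptions, so nothing can
  be said about them before existence and uniqueness are known. This calls for the projection
  theorem, Riesz representation and the extension of isometries from dense sets.

  The other obstacle is that \<alpha> is prescribed only on B \<otimes> 1 and may move 1 \<otimes>
  \<open>M_n\<close>. A trace on B \<otimes> \<open>M_n\<close> is nevertheless fixed by its values
  on B \<otimes> 1: for fixed b, sending m to the trace of b \<otimes> m is a tracial functional on
  \<open>M_n\<close>, hence a multiple of tr, and the multiple is read off at m = 1.

  The factor n undoes the normalization of tr: \<open>e_F\<close> sends (b \<otimes> m)\<Omega> to
  tr(m)(b \<otimes> 1)\<Omega>, and \<open>u_ji (b \<otimes> m)\<close> has matrix part of
  normalized trace \<open>m_ij / n\<close>. As \<nu> need not be a state, \<mu>bar(1) is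
  \<open>n^2 \<nu>(1)\<close> in general; what counts is that it is finite.\<close>

section \<open>Inner products\<close>

lemma cinner_minus_right: "cinner x (- y) = - cinner x y"
  for x y :: "'a::complex_hilbert_space"
  by (metis add.right_inverse add_cancel_left_left add_eq_0_iff cinner_add_right)

lemma cinner_diff_right: "cinner x (y - z) = cinner x y - cinner x z"
  for x y z :: "'a::complex_hilbert_space"
  by (metis cinner_add_right cinner_minus_right diff_conv_add_uminus)

lemma cinner_diff_left: "cinner (x - y) z = cinner x z - cinner y z"
  for x y z :: "'a::complex_hilbert_space"
  by (metis cinner_commute cinner_diff_right complex_cnj_diff)

lemma cinner_eq_zero_sym: "cinner x y = 0 \<longleftrightarrow> cinner y x = 0"
  for x y :: "'a::complex_hilbert_space"
  using cinner_commute[of x y] by simp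

lemma cinner_zero_right [simp]: "cinner x 0 = 0"
  for x :: "'a::complex_hilbert_space"
  using cinner_diff_right[of x 0 0] by simp

lemma cinner_zero_left [simp]: "cinner 0 x = 0"
  for x :: "'a::complex_hilbert_space"
  using cinner_diff_left[of 0 0 x] by simp

lemma cinner_sum_right: "cinner x (sum f S) = (\<Sum>i\<in>S. cinner x (f i))"
  for x :: "'a::complex_hilbert_space"
  by (induction S rule: infinite_finite_induct) (simp_all add: cinner_add_right)

lemma cinner_sum_left: "cinner (sum f S) x = (\<Sum>i\<in>S. cinner (f i) x)"
  for x :: "'a::complex_hilbert_space"
  by (induction S rule: infinite_finite_induct) (simp_all add: cinner_add_left)

lemma scaleC_one [simp]: "1 *\<^sub>C x = x"
  for x :: "'a::complex_hilbert_space"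
  using scaleR_scaleC[of 1 x] by simp

lemma scaleC_zero_left [simp]: "0 *\<^sub>C x = 0"
  for x :: "'a::complex_hilbert_space"
  using scaleR_scaleC[of 0 x] by simp

lemma scaleC_zero_right [simp]: "c *\<^sub>C 0 = (0 :: 'a::complex_hilbert_space)"
  using bounded_linear.linear[OF bounded_linear_scaleC] linear_0 by blast

lemma scaleC_minus1: "(-1) *\<^sub>C x = - x"
  for x :: "'a::complex_hilbert_space"
  using scaleR_scaleC[of "-1" x] by simp

lemma scaleC_sum_left: "sum f S *\<^sub>C x = (\<Sum>i\<in>S. f i *\<^sub>C x)"
  for x :: "'a::complex_hilbert_space"
  by (induction S rule: infinite_finite_induct) (simp_all add: scaleC_add_left)

lemma scaleC_sum_right: "c *\<^sub>C sum f S = (\<Sum>i\<in>S. c *\<^sub>C f i)"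
  for f :: "'i \<Rightarrow> 'a::complex_hilbert_space"
  by (induction S rule: infinite_finite_induct) (simp_all add: scaleC_add_right)

lemma csubspace_add: "csubspace V \<Longrightarrow> x \<in> V \<Longrightarrow> y \<in> V \<Longrightarrow> x + y \<in> V"
  and csubspace_scaleC: "csubspace V \<Longrightarrow> x \<in> V \<Longrightarrow> c *\<^sub>C x \<in> V"
  by (simp_all add: csubspace_def)

lemma csubspace_diff: "csubspace V \<Longrightarrow> x \<in> V \<Longrightarrow> y \<in> V \<Longrightarrow> x - y \<in> V"
  for x y :: "'a::complex_hilbert_space"
  unfolding csubspace_def by (metis diff_conv_add_uminus scaleC_minus1)

lemma norm_sq_cinner: "(norm x)\<^sup>2 = Re (cinner x x)"
  for x :: "'a::complex_hilbert_space"
  by (simp add: cinner_norm)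

lemma norm_add_sq: "(norm (x + y))\<^sup>2 = (norm x)\<^sup>2 + (norm y)\<^sup>2 + 2 * Re (cinner x y)"
  for x y :: "'a::complex_hilbert_space"
  using cinner_commute[of x y] by (simp add: norm_sq_cinner cinner_add_left cinner_add_right)

lemma norm_diff_sq: "(norm (x - y))\<^sup>2 = (norm x)\<^sup>2 + (norm y)\<^sup>2 - 2 * Re (cinner x y)"
  for x y :: "'a::complex_hilbert_space"
  using cinner_commute[of x y] by (simp add: norm_sq_cinner cinner_diff_left cinner_diff_right)

lemma parallelogram: "(norm (x + y))\<^sup>2 + (norm (x - y))\<^sup>2 = 2 * (norm x)\<^sup>2 + 2 * (norm y)\<^sup>2"
  for x y :: "'a::complex_hilbert_space"
  by (simp add: norm_add_sq norm_diff_sq)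

text \<open>Cauchy-Schwarz: \<open>c *\<^sub>C x\<close> is the orthogonal projection of
  \<open>y\<close> onto the line of \<open>x\<close>, and the squared norm of the remainder is
  nonnegative.\<close>

lemma norm_cinner_le: "cmod (cinner x y) \<le> norm x * norm y"
  for x y :: "'a::complex_hilbert_space"
proof (cases "x = 0")
  case False
  define n where "n = (norm x)\<^sup>2"
  have n: "n > 0" using False by (simp add: n_def)
  define c where "c = cinner x y / of_real n"
  have "cinner y (c *\<^sub>C x) = of_real ((cmod (cinner x y))\<^sup>2 / n)"
    using complex_norm_square[of "cinner x y"]
    by (simp add: c_def cinner_scaleC_right cinner_commute[of y x])
  then have "Re (cinner y (c *\<^sub>C x)) = (cmod (cinner x y))\<^sup>2 / n"
    by simp
  moreover have "(norm (c *\<^sub>C x))\<^sup>2 = (cmod (cinner x y))\<^sup>2 / n"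
    using n by (simp add: norm_scaleC c_def norm_divide power_mult_distrib power_divide
        n_def[symmetric]) (simp add: power2_eq_square)
  ultimately have "(norm (y - c *\<^sub>C x))\<^sup>2 = (norm y)\<^sup>2 - (cmod (cinner x y))\<^sup>2 / n"
    by (simp add: norm_diff_sq)
  then have "(cmod (cinner x y))\<^sup>2 / n \<le> (norm y)\<^sup>2"
    by (metis diff_ge_0_iff_ge zero_le_power2)
  then have "(cmod (cinner x y))\<^sup>2 \<le> (norm x * norm y)\<^sup>2"
    using n by (simp add: field_simps power_mult_distrib n_def)
  then show ?thesis
    by (rule power2_le_imp_le) simp
qed simp

lemma bounded_bilinear_cinner: "bounded_bilinear (cinner :: 'a::complex_hilbert_space \<Rightarrow> 'a \<Rightarrow> complex)"
proof
  show "\<exists>K. \<forall>a b :: 'a. norm (cinner a b) \<le> norm a * norm b * K"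
    by (rule exI[of _ 1]) (simp add: norm_cinner_le)
qed (simp_all add: cinner_add_left cinner_add_right scaleR_scaleC cinner_scaleC_left
      cinner_scaleC_right scaleC_complex_def)

lemmas continuous_on_cinner [continuous_intros] =
  bounded_bilinear.continuous_on[OF bounded_bilinear_cinner]

lemmas continuous_on_scaleC [continuous_intros] =
  bounded_linear.continuous_on[OF bounded_linear_scaleC]

lemma cinner_eq_zero_iff: "cinner x x = 0 \<longleftrightarrow> x = 0"
  for x :: "'a::complex_hilbert_space"
  by (simp add: cinner_norm)

lemma cinner_ext: "(\<And>z. cinner z x = cinner z y) \<Longrightarrow> x = y"
  for x y :: "'a::complex_hilbert_space"
  by (metis cinner_diff_right cinner_eq_zero_iff eq_iff_diff_eq_0)

lemma cinner_ext_left: "(\<And>z. cinner x z = cinner y z) \<Longrightarrow> x = y"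
  for x y :: "'a::complex_hilbert_space"
  by (metis cinner_commute cinner_ext)

section \<open>Orthogonal projections and adjoints\<close>

lemma csubspace_ocompl: "csubspace (ocompl V)"
  unfolding csubspace_def ocompl_def by (simp add: cinner_add_right cinner_scaleC_right)

lemma closed_ocompl: "closed (ocompl V)"
proof -
  have "ocompl V = (\<Inter>v\<in>V. {x. cinner v x = 0})"
    by (auto simp: ocompl_def)
  then show ?thesis
    by (auto intro!: closed_Collect_eq continuous_intros)
qed

text \<open>Orthogonality to a fixed vector is a closed condition. Orthogonality to
  \<open>H_F\<close> can therefore be tested on the explicit vectors of F\<Omega>.\<close>

lemma ocompl_closure: "ocompl (closure V) = ocompl V"
proof
  show "ocompl V \<subseteq> ocompl (closure V)"
  proof
    fix x assume "x \<in> ocompl V"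
    moreover have "closed {v. cinner v x = 0}"
      by (intro closed_Collect_eq continuous_intros)
    ultimately show "x \<in> ocompl (closure V)"
      using closure_minimal[of V "{v. cinner v x = 0}"] by (auto simp: ocompl_def)
  qed
qed (use closure_subset in \<open>auto simp: ocompl_def\<close>)

lemma csubspace_closure:
  fixes V :: "'a::complex_hilbert_space set"
  assumes "csubspace V"
  shows "csubspace (closure V)"
  unfolding csubspace_def
proof (intro conjI ballI allI)
  show "0 \<in> closure V"
    using assms closure_subset by (auto simp: csubspace_def)
next
  fix x y assume "x \<in> closure V" "y \<in> closure V"
  then obtain f g where "\<And>n. f n \<in> V" "f \<longlonglongrightarrow> x" "\<And>n. g n \<in> V" "g \<longlonglongrightarrow> y"
    by (auto simp: closure_sequential)
  with assms show "x + y \<in> closure V"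
    unfolding closure_sequential csubspace_def
    by (intro exI[of _ "\<lambda>n. f n + g n"]) (auto intro: tendsto_add)
next
  fix x and c assume "x \<in> closure V"
  then obtain f where "\<And>n. f n \<in> V" "f \<longlonglongrightarrow> x"
    by (auto simp: closure_sequential)
  with assms show "c *\<^sub>C x \<in> closure V"
    unfolding closure_sequential csubspace_def
    by (intro exI[of _ "\<lambda>n. c *\<^sub>C f n"])
      (auto intro: bounded_linear.tendsto[OF bounded_linear_scaleC])
qed

text \<open>The projection theorem, by a minimizing sequence for the distance from \<open>x\<close>
  to \<open>V\<close>: the parallelogram law makes it Cauchy, and minimality of the limit forces
  orthogonality.\<close>

lemma orthogonal_decomposition:
  fixes x :: "'a::complex_hilbert_space"
  assumes V: "csubspace V" "closed V"
  shows "\<exists>p\<in>V. x - p \<in> ocompl V"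
proof -
  define D where "D = (\<lambda>v. (norm (x - v))\<^sup>2) ` V"
  define d where "d = Inf D"
  have "D \<noteq> {}" using V by (auto simp: D_def csubspace_def)
  have bdd: "bdd_below D" unfolding D_def by (intro bdd_belowI2[of _ 0]) simp
  have d_le: "d \<le> (norm (x - v))\<^sup>2" if "v \<in> V" for v
    unfolding d_def using bdd that by (intro cInf_lower) (auto simp: D_def)
  have "\<exists>v\<in>V. (norm (x - v))\<^sup>2 < d + 1 / real (Suc n)" for n
    using cInf_lessD[OF \<open>D \<noteq> {}\<close>, of "d + 1 / real (Suc n)"] by (auto simp: d_def D_def)
  then obtain v where v: "\<And>n. v n \<in> V" "\<And>n. (norm (x - v n))\<^sup>2 < d + 1 / real (Suc n)"
    by metis
  have dist_v: "(dist (v m) (v n))\<^sup>2 \<le> 2 / real (Suc m) + 2 / real (Suc n)" for m n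
  proof -
    \<comment> \<open>The midpoint lies in \<open>V\<close>, so the sum term of the parallelogram
      law is at least \<open>4 * d\<close>; only the two approximation errors remain for the
      distance.\<close>
    define w where "w = (1/2) *\<^sub>R (v m + v n)"
    have "w \<in> V" using V v by (auto simp: w_def csubspace_def scaleR_scaleC)
    have "(x - v m) + (x - v n) = 2 *\<^sub>R (x - w)"
      by (simp add: w_def algebra_simps scaleR_2)
    then have "(norm ((x - v m) + (x - v n)))\<^sup>2 = 4 * (norm (x - w))\<^sup>2"
      by (simp add: power_mult_distrib)
    then have "4 * d \<le> (norm ((x - v m) + (x - v n)))\<^sup>2"
      using d_le[OF \<open>w \<in> V\<close>] by simp
    moreover have "dist (v m) (v n) = norm ((x - v m) - (x - v n))"
      by (simp add: dist_norm norm_minus_commute)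
    ultimately show ?thesis
      using parallelogram[of "x - v m" "x - v n"] v(2)[of m] v(2)[of n] by simp
  qed
  have "Cauchy v"
  proof (rule metric_CauchyI)
    fix e :: real assume "e > 0"
    \<comment> \<open>With a quarter of \<open>e\<^sup>2\<close> here, each of the two errors in
      \<open>dist_v\<close> falls below half of \<open>e\<^sup>2\<close>.\<close>
    then obtain N where N: "inverse (real (Suc N)) < e\<^sup>2 / 4"
      using reals_Archimedean[of "e\<^sup>2 / 4"] by auto
    have "dist (v m) (v n) < e" if "m \<ge> N" "n \<ge> N" for m n
    proof -
      have "2 / real (Suc m) \<le> 2 / real (Suc N)" "2 / real (Suc n) \<le> 2 / real (Suc N)"
        using that by (auto intro!: divide_left_mono)
      then have "(dist (v m) (v n))\<^sup>2 < e\<^sup>2"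
        using dist_v[of m n] N by (simp add: inverse_eq_divide)
      then show ?thesis
        using \<open>e > 0\<close> by (simp add: power_less_imp_less_base)
    qed
    then show "\<exists>N. \<forall>m\<ge>N. \<forall>n\<ge>N. dist (v m) (v n) < e" by blast
  qed
  then obtain p where p: "v \<longlonglongrightarrow> p"
    using Cauchy_convergent convergent_def by blast
  have "p \<in> V"
    using closed_sequentially[OF V(2)] v(1) p by blast
  have "(\<lambda>n. (norm (x - v n))\<^sup>2) \<longlonglongrightarrow> (norm (x - p))\<^sup>2"
    using p by (intro tendsto_intros)
  moreover have "(\<lambda>n. d + 1 / real (Suc n)) \<longlonglongrightarrow> d + 0"
    by (intro tendsto_intros LIMSEQ_Suc lim_1_over_n)
  ultimately have "(norm (x - p))\<^sup>2 \<le> d + 0"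
    by (rule LIMSEQ_le) (use v(2) in \<open>auto intro: less_imp_le\<close>)
  then have p_le: "(norm (x - p))\<^sup>2 \<le> d" by simp
  have "cinner u (x - p) = 0" if "u \<in> V" for u
  proof (cases "u = 0")
    case False
    \<comment> \<open>Now \<open>c *\<^sub>C u\<close> is the projection of \<open>x - p\<close>
      onto the line of \<open>u\<close>. Adding it to \<open>p\<close> would give a point of
      \<open>V\<close> strictly closer to \<open>x\<close> unless the coefficient vanishes.\<close>
    define c where "c = cinner u (x - p) / of_real ((norm u)\<^sup>2)"
    have "p + c *\<^sub>C u \<in> V"
      using \<open>p \<in> V\<close> that V by (auto simp: csubspace_def)
    then have "(norm (x - p))\<^sup>2 \<le> (norm ((x - p) - c *\<^sub>C u))\<^sup>2"
      using p_le d_le[of "p + c *\<^sub>C u"] unfolding diff_diff_eq by linarith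
    then have le: "2 * Re (cinner (x - p) (c *\<^sub>C u)) \<le> (norm (c *\<^sub>C u))\<^sup>2"
      by (simp add: norm_diff_sq)
    have "cinner (x - p) (c *\<^sub>C u) = of_real ((cmod (cinner u (x - p)))\<^sup>2 / (norm u)\<^sup>2)"
      using complex_norm_square[of "cinner u (x - p)"]
      by (simp add: c_def cinner_scaleC_right cinner_commute[of "x - p" u])
    then have "Re (cinner (x - p) (c *\<^sub>C u)) = (cmod (cinner u (x - p)))\<^sup>2 / (norm u)\<^sup>2"
      by simp
    moreover have "(norm (c *\<^sub>C u))\<^sup>2 = (cmod (cinner u (x - p)))\<^sup>2 / (norm u)\<^sup>2"
      using False
      by (simp add: norm_scaleC c_def norm_divide norm_power power_mult_distrib power_divide)
        (simp add: power2_eq_square power4_eq_xxxx)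
    ultimately have "(cmod (cinner u (x - p)))\<^sup>2 / (norm u)\<^sup>2 \<le> 0"
      using le by simp
    then show ?thesis
      using False by (simp add: divide_le_0_iff)
  qed simp
  then show ?thesis
    using \<open>p \<in> V\<close> by (auto simp: ocompl_def)
qed

lemma orthogonal_decomposition_unique:
  fixes x :: "'a::complex_hilbert_space"
  assumes "csubspace V" "p \<in> V" "q \<in> V" "x - p \<in> ocompl V" "x - q \<in> ocompl V"
  shows "p = q"
proof -
  have "p - q \<in> V" using assms csubspace_diff by blast
  moreover have "p - q \<in> ocompl V"
    using csubspace_diff[OF csubspace_ocompl assms(5,4)] by simp
  ultimately show ?thesis
    using cinner_eq_zero_iff[of "p - q"] by (simp add: ocompl_def)
qed

lemma proj_eqI:
  fixes P :: "'a::complex_hilbert_space \<Rightarrow>\<^sub>L 'a"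
  assumes "csubspace V" "\<And>x. P x \<in> V" "\<And>x. x - P x \<in> ocompl V"
  shows "proj V = P"
  unfolding proj_def
proof (rule the_equality)
  fix Q :: "'a \<Rightarrow>\<^sub>L 'a"
  assume "\<forall>x. Q x \<in> V \<and> x - Q x \<in> ocompl V"
  then show "Q = P"
    using assms orthogonal_decomposition_unique by (intro blinfun_eqI) blast
qed (use assms in auto)

text \<open>Uniqueness of the decomposition makes the chosen map \<open>p\<close> linear, and
  Pythagoras makes it a contraction. Only then is it an operator that \<open>proj\<close> can
  describe.\<close>

lemma
  assumes V: "csubspace V" "closed V"
  shows proj_mem: "proj V x \<in> V"
    and diff_proj_mem: "x - proj V x \<in> ocompl V"
    and proj_bounded_ops: "proj V \<in> bounded_ops"
proof -
  obtain p where p: "\<And>x. p x \<in> V" "\<And>x. x - p x \<in> ocompl V"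
    using orthogonal_decomposition[OF V] by metis
  have p_eq: "p x = y" if "y \<in> V" "x - y \<in> ocompl V" for x y
    using orthogonal_decomposition_unique[OF V(1)] p that by blast
  have add: "p (x + y) = p x + p y" for x y
  proof (rule p_eq)
    show "p x + p y \<in> V" using V p by (auto simp: csubspace_def)
    have "(x - p x) + (y - p y) \<in> ocompl V"
      using p csubspace_ocompl by (blast intro: csubspace_add)
    then show "x + y - (p x + p y) \<in> ocompl V" by (simp add: algebra_simps)
  qed
  have scale: "p (c *\<^sub>C x) = c *\<^sub>C p x" for c x
  proof (rule p_eq)
    show "c *\<^sub>C p x \<in> V" using V p by (auto simp: csubspace_def)
    have "c *\<^sub>C (x - p x) \<in> ocompl V"
      using p csubspace_ocompl by (blast intro: csubspace_scaleC)
    then show "c *\<^sub>C x - c *\<^sub>C p x \<in> ocompl V"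
      by (simp add: linear_diff[OF bounded_linear.linear[OF bounded_linear_scaleC]])
  qed
  have "norm (p x) \<le> norm x * 1" for x
  proof -
    have "cinner (p x) (x - p x) = 0" using p by (auto simp: ocompl_def)
    then have "(norm x)\<^sup>2 = (norm (p x))\<^sup>2 + (norm (x - p x))\<^sup>2"
      using norm_add_sq[of "p x" "x - p x"] by simp
    then show ?thesis
      by (simp add: power2_le_imp_le)
  qed
  then have "bounded_linear p"
    by (intro bounded_linear_intro[of p 1]) (simp_all add: add scale scaleR_scaleC)
  then have app: "blinfun_apply (Blinfun p) = p"
    by (rule bounded_linear_Blinfun_apply)
  have "proj V = Blinfun p"
    by (rule proj_eqI[OF V(1)]) (simp_all add: app p)
  then show "proj V x \<in> V" "x - proj V x \<in> ocompl V" "proj V \<in> bounded_ops"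
    by (simp_all add: app p bounded_ops_def scale)
qed

lemma positive_proj:
  assumes "csubspace V" "closed V"
  shows "positive_op (proj V)"
  unfolding positive_op_def
proof
  fix x
  have "cinner (x - proj V x) (proj V x) = 0"
    using proj_mem[OF assms, of x] diff_proj_mem[OF assms, of x]
    by (simp add: ocompl_def cinner_eq_zero_sym[of "x - proj V x"])
  then have "cinner x (proj V x) = cinner (proj V x) (proj V x)"
    by (simp add: cinner_diff_left)
  then show "cinner x (proj V x) \<in> \<real>\<^sub>\<ge>\<^sub>0"
    by (simp add: cinner_norm)
qed

lemma proj_ocompl:
  assumes "csubspace V" "closed V"
  shows "proj (ocompl V) = id_blinfun - proj V"
proof (rule proj_eqI[OF csubspace_ocompl])
  fix x
  show "(id_blinfun - proj V) x \<in> ocompl V"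
    using diff_proj_mem[OF assms] by (simp add: blinfun.diff_left)
  have "cinner v (proj V x) = 0" if "v \<in> ocompl V" for v
    using that proj_mem[OF assms, of x] by (simp add: ocompl_def cinner_eq_zero_sym[of v])
  then show "x - (id_blinfun - proj V) x \<in> ocompl (ocompl V)"
    by (simp add: blinfun.diff_left) (auto simp: ocompl_def)
qed

section \<open>Riesz representation and existence of adjoints\<close>

lemma Riesz_representation:
  fixes f :: "'a::complex_hilbert_space \<Rightarrow> complex"
  assumes f: "bounded_linear f" and scale: "\<And>c x. f (c *\<^sub>C x) = c * f x"
  shows "\<exists>z. \<forall>x. f x = cinner z x"
proof (cases "\<forall>x. f x = 0")
  case True
  then show ?thesis by (intro exI[of _ 0]) simp
next
  case False
  then obtain u where u: "f u \<noteq> 0" by blast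
  define V where "V = {x. f x = 0}"
  have lin: "linear f" using f by (rule bounded_linear.linear)
  have "csubspace V"
    by (simp add: V_def csubspace_def linear_0[OF lin] linear_add[OF lin] scale)
  moreover have "closed V"
    unfolding V_def using f by (intro closed_Collect_eq linear_continuous_on) auto
  ultimately obtain p where p: "p \<in> V" "u - p \<in> ocompl V"
    using orthogonal_decomposition by blast
  \<comment> \<open>\<open>w\<close> is orthogonal to the kernel \<open>V\<close> of
    \<open>f\<close>, and every \<open>x\<close> differs from a multiple of \<open>w\<close> by an
    element of \<open>V\<close>. Pairing with \<open>w\<close> thus recovers \<open>f x\<close> up
    to a constant, which the scalar in the representing vector corrects.\<close>
  define w where "w = u - p"
  have fw: "f w \<noteq> 0"
    using p u by (simp add: w_def linear_diff[OF lin] V_def)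
  then have w0: "w \<noteq> 0" using linear_0[OF lin] by auto
  have "f x = cinner ((cnj (f w) / of_real ((norm w)\<^sup>2)) *\<^sub>C w) x" for x
  proof -
    have "x - (f x / f w) *\<^sub>C w \<in> V"
      using fw by (simp add: V_def linear_diff[OF lin] scale)
    then have "cinner (x - (f x / f w) *\<^sub>C w) w = 0"
      using p(2) by (simp add: ocompl_def w_def)
    then have "cinner w (x - (f x / f w) *\<^sub>C w) = 0"
      by (simp add: cinner_eq_zero_sym[of w])
    then have "cinner w x = f x / f w * of_real ((norm w)\<^sup>2)"
      by (simp add: cinner_diff_right cinner_scaleC_right cinner_norm)
    then show ?thesis
      using fw w0 by (simp add: cinner_scaleC_left)
  qed
  then show ?thesis by blast
qed

lemma adj_eqI:
  fixes S T :: "'a::complex_hilbert_space \<Rightarrow>\<^sub>L 'a"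
  assumes "\<And>x y. cinner (S x) y = cinner x (T y)"
  shows "adj T = S"
  unfolding adj_def
proof (rule the_equality)
  fix R :: "'a \<Rightarrow>\<^sub>L 'a"
  assume "\<forall>x y. cinner (R x) y = cinner x (T y)"
  then show "R = S"
    using assms by (simp add: blinfun_eqI cinner_ext_left)
qed (use assms in auto)

text \<open>Riesz supplies, for each \<open>x\<close>, the vector \<open>s x\<close> representing
  the functional that sends \<open>y\<close> to the inner product of \<open>x\<close> with
  \<open>T y\<close>. Taking \<open>y = s x\<close> in Cauchy-Schwarz and cancelling one factor
  \<open>norm (s x)\<close> bounds \<open>s\<close> by \<open>norm T\<close>.\<close>

lemma adj_works:
  assumes T: "T \<in> bounded_ops"
  shows "cinner (adj T x) y = cinner x (T y)"
proof -
  have "\<exists>z. \<forall>y. cinner x (T y) = cinner z y" for x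
  proof (rule Riesz_representation)
    show "bounded_linear (\<lambda>y. cinner x (T y))"
      by (rule bounded_linear_compose[OF
            bounded_bilinear.bounded_linear_right[OF bounded_bilinear_cinner] blinfun.bounded_linear_right])
    show "cinner x (T (c *\<^sub>C y)) = c * cinner x (T y)" for c y
      using T by (simp add: bounded_ops_def cinner_scaleC_right)
  qed
  then obtain s where s: "\<And>x y. cinner x (T y) = cinner (s x) y" by metis
  have "norm (s x) \<le> norm x * norm T" for x
  proof -
    have "(norm (s x))\<^sup>2 = cmod (cinner x (T (s x)))"
      by (simp add: s cinner_norm norm_power)
    also have "\<dots> \<le> norm x * (norm T * norm (s x))"
      by (rule order_trans[OF norm_cinner_le]) (simp add: mult_left_mono norm_blinfun)
    finally have "norm (s x) * norm (s x) \<le> (norm x * norm T) * norm (s x)"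
      by (simp add: power2_eq_square mult_ac)
    then show ?thesis
      by (cases "norm (s x) = 0") (simp_all add: mult_le_cancel_right)
  qed
  moreover have "s (x + y) = s x + s y" "s (c *\<^sub>C x) = c *\<^sub>C s x" for x y c
    by (rule cinner_ext_left; simp add: cinner_add_left cinner_scaleC_left flip: s)+
  ultimately have "bounded_linear s"
    by (intro bounded_linear_intro[of s "norm T"]) (simp_all add: scaleR_scaleC)
  then have app: "blinfun_apply (Blinfun s) = s"
    by (rule bounded_linear_Blinfun_apply)
  have "adj T = Blinfun s"
    by (rule adj_eqI) (simp add: app s)
  then show ?thesis
    by (simp add: app s)
qed

lemma adj_works': "T \<in> bounded_ops \<Longrightarrow> cinner x (adj T y) = cinner (T x) y"
  using adj_works[of T y x] cinner_commute[of x] cinner_commute[of "T x"] by simp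

lemma adj_bounded_ops:
  assumes "T \<in> bounded_ops"
  shows "adj T \<in> bounded_ops"
proof -
  have "adj T (c *\<^sub>C x) = c *\<^sub>C adj T x" for c x
    by (rule cinner_ext_left) (simp add: adj_works[OF assms] cinner_scaleC_left)
  then show ?thesis by (simp add: bounded_ops_def)
qed

lemma adj_adj: "T \<in> bounded_ops \<Longrightarrow> adj (adj T) = T"
  by (rule adj_eqI) (simp add: adj_works')

section \<open>Isometries defined on dense sets\<close>

lemma eq_on_dense:
  fixes f g :: "'a::topological_space \<Rightarrow> 'b::t2_space"
  assumes "closure S = UNIV" "continuous_on UNIV f" "continuous_on UNIV g"
    and "\<And>x. x \<in> S \<Longrightarrow> f x = g x"
  shows "f x = g x"
proof -
  have "closure S \<subseteq> {x. f x = g x}"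
    using assms by (intro closure_minimal closed_Collect_eq) auto
  then show ?thesis using assms(1) by auto
qed

text \<open>The families \<open>p\<close> and \<open>q\<close> encode a partial map from
  \<open>p a\<close> to \<open>q a\<close>. Preserved distances make it well defined, since indices
  with equal \<open>p\<close> have \<open>q\<close> at distance 0, and uniformly continuous, so that
  it extends to the closure.\<close>

lemma isometry_extension:
  fixes p :: "'i \<Rightarrow> 'a::metric_space" and q :: "'i \<Rightarrow> 'b::complete_space"
  assumes dense: "closure (p ` I) = UNIV"
    and dist: "\<And>a b. a \<in> I \<Longrightarrow> b \<in> I \<Longrightarrow> dist (q a) (q b) = dist (p a) (p b)"
  shows "\<exists>g. continuous_on UNIV g \<and> (\<forall>a\<in>I. g (p a) = q a)"
proof -
  define f where "f x = q (SOME a. a \<in> I \<and> p a = x)" for x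
  have some: "(SOME b. b \<in> I \<and> p b = p a) \<in> I \<and> p (SOME b. b \<in> I \<and> p b = p a) = p a"
    if "a \<in> I" for a
    using that by (intro someI[of "\<lambda>b. b \<in> I \<and> p b = p a" a]) simp
  have f: "f (p a) = q a" if "a \<in> I" for a
    using dist[of "SOME b. b \<in> I \<and> p b = p a" a] some[OF that] that by (simp add: f_def)
  have "uniformly_continuous_on (p ` I) f"
    unfolding uniformly_continuous_on_def using dist f by fastforce
  from uniformly_continuous_on_extension_on_closure[OF this]
  obtain g where "uniformly_continuous_on (closure (p ` I)) g" "\<And>x. x \<in> p ` I \<Longrightarrow> f x = g x"
    by metis
  then show ?thesis
    using dense f by (intro exI[of _ g]) (force intro: uniformly_continuous_imp_continuous)
qed

text \<open>Surjectivity comes from symmetry: the reverse assignment is isometric too, and its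
  extension \<open>h\<close> satisfies \<open>g (h x) = x\<close> on the dense range of
  \<open>q\<close>, hence everywhere.\<close>

lemma bijective_isometry_extension:
  fixes p q :: "'i \<Rightarrow> 'a::complete_space"
  assumes p: "closure (p ` I) = UNIV" and q: "closure (q ` I) = UNIV"
    and dist: "\<And>a b. a \<in> I \<Longrightarrow> b \<in> I \<Longrightarrow> dist (q a) (q b) = dist (p a) (p b)"
  obtains g where "continuous_on UNIV g" "surj g" "\<And>a. a \<in> I \<Longrightarrow> g (p a) = q a"
proof -
  obtain g where g: "continuous_on UNIV g" "\<And>a. a \<in> I \<Longrightarrow> g (p a) = q a"
    using isometry_extension[OF p dist] by auto
  obtain h where h: "continuous_on UNIV h" "\<And>a. a \<in> I \<Longrightarrow> h (q a) = p a"
    using isometry_extension[OF q dist[symmetric]] by auto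
  have "g (h x) = x" for x
    by (rule eq_on_dense[OF q, where f = "\<lambda>x. g (h x)"])
      (auto simp: g h intro!: continuous_intros continuous_on_compose2[OF g(1) h(1)])
  then have "surj g" by (metis surjI)
  with g that show ?thesis by blast
qed

text \<open>Distances see only the real part of the inner product. The same criterion therefore
  serves unitary maps and antiunitary ones, which conjugate inner products.\<close>

lemma dist_eqI_cinner:
  fixes x y :: "'a::complex_hilbert_space" and x' y' :: "'b::complex_hilbert_space"
  assumes "cinner x' x' = cinner x x" "cinner y' y' = cinner y y"
    "Re (cinner x' y') = Re (cinner x y)"
  shows "dist x' y' = dist x y"
proof -
  have "(norm (x' - y'))\<^sup>2 = (norm (x - y))\<^sup>2"
    unfolding norm_diff_sq by (simp add: norm_sq_cinner assms)
  then show ?thesis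
    by (simp add: dist_norm power2_eq_iff_nonneg)
qed

lemma cinner_eq_on_dense:
  fixes g h :: "'a::topological_space \<Rightarrow> 'b::complex_hilbert_space"
    and g' h' :: "'a \<Rightarrow> 'c::complex_hilbert_space"
  assumes S: "closure S = UNIV"
    and cont: "continuous_on UNIV g" "continuous_on UNIV h" "continuous_on UNIV g'" "continuous_on UNIV h'"
    and eq: "\<And>x y. x \<in> S \<Longrightarrow> y \<in> S \<Longrightarrow> cinner (g x) (h y) = cinner (g' x) (h' y)"
  shows "cinner (g x) (h y) = cinner (g' x) (h' y)"
proof -
  have "cinner (g x) (h y) = cinner (g' x) (h' y)" if "x \<in> S" for x y
    by (rule eq_on_dense[OF S, where x = y]) (auto simp: eq that intro!: continuous_intros cont)
  then show ?thesis
    by (intro eq_on_dense[OF S, where x = x and f = "\<lambda>x. cinner (g x) (h y)"])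
      (auto intro!: continuous_intros cont)
qed

lemma unitary_extension:
  fixes p q :: "'i \<Rightarrow> 'h::complex_hilbert_space"
  assumes p: "closure (p ` I) = UNIV" and q: "closure (q ` I) = UNIV"
    and inner: "\<And>a b. a \<in> I \<Longrightarrow> b \<in> I \<Longrightarrow> cinner (q a) (q b) = cinner (p a) (p b)"
  obtains U where "unitary_op U" "\<And>a. a \<in> I \<Longrightarrow> U (p a) = q a"
proof -
  obtain g where g: "continuous_on UNIV g" "surj g" "\<And>a. a \<in> I \<Longrightarrow> g (p a) = q a"
    by (rule bijective_isometry_extension[OF p q]) (auto simp: inner intro: dist_eqI_cinner)
  have inner_g: "cinner (g x) (g y) = cinner x y" for x y
    by (rule cinner_eq_on_dense[OF p g(1) g(1), where g' = "\<lambda>x. x" and h' = "\<lambda>x. x"])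
      (auto simp: g inner)
  \<comment> \<open>Since \<open>g\<close> is onto, vectors may be compared by their inner products
    with values of \<open>g\<close>. Linearity of \<open>g\<close> then follows from preservation of
    inner products alone.\<close>
  have eqI: "u = v" if "\<And>w. cinner (g w) u = cinner (g w) v" for u v
    using that \<open>surj g\<close> by (metis cinner_ext surjD)
  have add: "g (x + y) = g x + g y" for x y
    by (rule eqI) (simp add: inner_g cinner_add_right)
  have scale: "g (c *\<^sub>C x) = c *\<^sub>C g x" for c x
    by (rule eqI) (simp add: inner_g cinner_scaleC_right)
  have "(norm (g x))\<^sup>2 = (norm x)\<^sup>2" for x
    by (simp only: norm_sq_cinner inner_g)
  then have "norm (g x) = norm x" for x
    by (simp add: power2_eq_iff_nonneg)
  then have "bounded_linear g"
    by (intro bounded_linear_intro[of g 1]) (simp_all add: add scale scaleR_scaleC)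
  then have app: "blinfun_apply (Blinfun g) = g"
    by (rule bounded_linear_Blinfun_apply)
  define U where "U = Blinfun g"
  have U: "U \<in> bounded_ops"
    by (simp add: U_def bounded_ops_def app scale)
  have "adj U (U x) = x" for x
    by (rule cinner_ext_left) (simp add: adj_works[OF U], simp add: U_def app inner_g)
  moreover from this have "U (adj U x) = x" for x
    using \<open>surj g\<close> by (metis U_def app surjD)
  ultimately have "unitary_op U"
    using U by (auto simp: unitary_op_def intro!: blinfun_eqI)
  then show thesis
    using that by (simp add: U_def app g)
qed

lemma unitary_cinner: "unitary_op U \<Longrightarrow> cinner (U x) (U y) = cinner x y"
  by (metis adj_works blinfun_apply_blinfun_compose id_blinfun.rep_eq unitary_op_def)

lemma unitary_surj: "unitary_op U \<Longrightarrow> surj (blinfun_apply U)"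
  by (metis blinfun_apply_blinfun_compose id_blinfun.rep_eq surjI unitary_op_def)

lemma antiunitary_extension:
  fixes p q :: "'i \<Rightarrow> 'h::complex_hilbert_space"
  assumes p: "closure (p ` I) = UNIV" and q: "closure (q ` I) = UNIV"
    and inner: "\<And>a b. a \<in> I \<Longrightarrow> b \<in> I \<Longrightarrow> cinner (q a) (q b) = cinner (p b) (p a)"
  obtains J where "antiunitary J" "\<And>a. a \<in> I \<Longrightarrow> J (p a) = q a"
proof -
  have dist: "dist (q a) (q b) = dist (p a) (p b)" if "a \<in> I" "b \<in> I" for a b
    using inner[OF that] cinner_commute[of "p a" "p b"] that
    by (intro dist_eqI_cinner) (simp_all add: inner)
  obtain g where g: "continuous_on UNIV g" "surj g" "\<And>a. a \<in> I \<Longrightarrow> g (p a) = q a"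
    using bijective_isometry_extension[OF p q dist] by blast
  have "cinner (g x) (g y) = cnj (cinner x y)" for x y
  proof -
    have "cinner (g x) (g y) = cnj (cinner x y)" if x: "x \<in> p ` I" for x y
    proof -
      obtain a where a: "a \<in> I" "x = p a" using x by blast
      show ?thesis
        by (rule eq_on_dense[OF p, where x = y])
          (auto simp: g inner a intro: cinner_commute intro!: continuous_intros continuous_on_cnj g(1))
    qed
    then show ?thesis
      by (intro eq_on_dense[OF p, where x = x and f = "\<lambda>x. cinner (g x) (g y)"])
        (auto intro!: continuous_intros g(1) continuous_on_cnj)
  qed
  then have inner_g: "cinner (g x) (g y) = cinner y x" for x y
    using cinner_commute[of y x] by simp
  have eqI: "u = v" if "\<And>w. cinner (g w) u = cinner (g w) v" for u v
    using that \<open>surj g\<close> by (metis cinner_ext surjD)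
  have "g (x + y) = g x + g y" for x y
    by (rule eqI) (simp add: inner_g cinner_add_right cinner_add_left)
  moreover have "g (c *\<^sub>C x) = cnj c *\<^sub>C g x" for c x
    by (rule eqI) (simp add: inner_g cinner_scaleC_right cinner_scaleC_left)
  ultimately have "antiunitary g"
    using \<open>surj g\<close> by (simp add: antiunitary_def inner_g)
  then show thesis
    using that g(3) by blast
qed

lemma continuous_on_antiunitary:
  assumes J: "antiunitary J"
  shows "continuous_on UNIV J"
proof -
  have "dist (J x) (J y) = dist x y" for x y
    using J cinner_commute[of x y] by (intro dist_eqI_cinner) (auto simp: antiunitary_def)
  then show ?thesis
    by (auto simp: continuous_on_iff)
qed

lemma blinfun_eq_iff: "S = T \<longleftrightarrow> (\<forall>x. blinfun_apply S x = blinfun_apply T x)"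
  by (auto intro: blinfun_eqI)

section \<open>Von Neumann algebras and tracial representations\<close>

text \<open>By the bicommutant condition, membership in \<open>M\<close> means commuting with every
  operator of \<open>commutant M\<close>, a condition stable under the algebra operations.\<close>

lemma
  assumes M: "von_neumann_algebra M"
  shows vna_bounded_ops: "M \<subseteq> bounded_ops"
    and vna_adj: "a \<in> M \<Longrightarrow> adj a \<in> M"
    and vna_id: "id_blinfun \<in> M"
    and vna_add: "a \<in> M \<Longrightarrow> b \<in> M \<Longrightarrow> a + b \<in> M"
    and vna_diff: "a \<in> M \<Longrightarrow> b \<in> M \<Longrightarrow> a - b \<in> M"
    and vna_scaleC: "a \<in> M \<Longrightarrow> c *\<^sub>C a \<in> M"
    and vna_compose: "a \<in> M \<Longrightarrow> b \<in> M \<Longrightarrow> a o\<^sub>L b \<in> M"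
proof -
  show "M \<subseteq> bounded_ops" "a \<in> M \<Longrightarrow> adj a \<in> M"
    using M by (auto simp: von_neumann_algebra_def)
  have mem: "T \<in> M \<longleftrightarrow> T \<in> bounded_ops \<and> (\<forall>s \<in> commutant M. \<forall>x. T (s x) = s (T x))" for T
  proof -
    have "T \<in> M \<longleftrightarrow> T \<in> commutant (commutant M)"
      using M by (simp add: von_neumann_algebra_def)
    then show ?thesis
      by (simp add: commutant_def[of "commutant M"] blinfun_eq_iff)
  qed
  have lin: "s (c *\<^sub>C x) = c *\<^sub>C s x" if "s \<in> commutant M" for s c x
    using that by (simp add: commutant_def bounded_ops_def)
  show "id_blinfun \<in> M"
    by (simp add: mem) (simp add: bounded_ops_def)
  show "a \<in> M \<Longrightarrow> b \<in> M \<Longrightarrow> a + b \<in> M"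
    by (simp add: mem blinfun.add_left blinfun.add_right)
      (simp add: bounded_ops_def scaleC_add_right blinfun.add_left)
  show "a \<in> M \<Longrightarrow> b \<in> M \<Longrightarrow> a - b \<in> M"
    by (simp add: mem blinfun.diff_left blinfun.diff_right)
      (simp add: bounded_ops_def blinfun.diff_left
        linear_diff[OF bounded_linear.linear[OF bounded_linear_scaleC]])
  show "a \<in> M \<Longrightarrow> c *\<^sub>C a \<in> M"
    by (simp add: mem scaleC_blinfun.rep_eq lin)
      (simp add: bounded_ops_def scaleC_blinfun.rep_eq scaleC_scaleC mult.commute)
  show "a \<in> M \<Longrightarrow> b \<in> M \<Longrightarrow> a o\<^sub>L b \<in> M"
    by (simp add: mem) (simp add: bounded_ops_def)
qed

text \<open>A star-algebra with a tracial vector state. These properties can be verified for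
  \<open>matrix_algebra\<close> on elementary tensors, and they give access to
  \<open>evolution\<close>, \<open>modular_conj\<close> and the right module structure.\<close>

locale tracial_gns =
  fixes M :: "('a::complex_hilbert_space \<Rightarrow>\<^sub>L 'a) set" and \<tau> :: "('a \<Rightarrow>\<^sub>L 'a) \<Rightarrow> complex"
    and \<pi> :: "('a \<Rightarrow>\<^sub>L 'a) \<Rightarrow> ('h::complex_hilbert_space \<Rightarrow>\<^sub>L 'h)" and \<Omega> :: 'h
  assumes bounded_ops: "M \<subseteq> bounded_ops"
    and compose_mem: "a \<in> M \<Longrightarrow> b \<in> M \<Longrightarrow> a o\<^sub>L b \<in> M"
    and adj_mem: "a \<in> M \<Longrightarrow> adj a \<in> M"
    and trace_commute: "a \<in> M \<Longrightarrow> b \<in> M \<Longrightarrow> \<tau> (a o\<^sub>L b) = \<tau> (b o\<^sub>L a)"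
    and star_hom: "star_hom_on M \<pi>"
    and image_bounded_ops: "\<pi> ` M \<subseteq> bounded_ops"
    and dense: "closure ((\<lambda>a. \<pi> a \<Omega>) ` M) = UNIV"
    and vector_state: "a \<in> M \<Longrightarrow> \<tau> a = cinner \<Omega> (\<pi> a \<Omega>)"
begin

lemma rep_compose: "a \<in> M \<Longrightarrow> b \<in> M \<Longrightarrow> \<pi> (a o\<^sub>L b) = \<pi> a o\<^sub>L \<pi> b"
  and rep_adj: "a \<in> M \<Longrightarrow> \<pi> (adj a) = adj (\<pi> a)"
  and rep_add: "a \<in> M \<Longrightarrow> b \<in> M \<Longrightarrow> \<pi> (a + b) = \<pi> a + \<pi> b"
  and rep_scaleC: "a \<in> M \<Longrightarrow> \<pi> (c *\<^sub>C a) = c *\<^sub>C \<pi> a"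
  using star_hom by (auto simp: star_hom_on_def clinear_on_def)

lemma rep_cinner:
  assumes "a \<in> M" "b \<in> M"
  shows "cinner (\<pi> a \<Omega>) (\<pi> b \<Omega>) = \<tau> (adj a o\<^sub>L b)"
  using assms image_bounded_ops
  by (simp add: vector_state compose_mem adj_mem rep_compose rep_adj adj_works' image_subset_iff)

text \<open>Invariance of \<tau> says that
  \<open>\<pi> a \<Omega> \<mapsto> \<pi> (\<alpha> a) \<Omega>\<close> preserves inner products;
  surjectivity of \<alpha> keeps the range dense. Density also gives uniqueness.\<close>

lemma evolution_exists:
  assumes \<alpha>: "star_automorphism M \<alpha>" "\<And>a. a \<in> M \<Longrightarrow> \<tau> (\<alpha> a) = \<tau> a"
  shows "\<exists>!U. unitary_op U \<and> (\<forall>a\<in>M. U (\<pi> a \<Omega>) = \<pi> (\<alpha> a) \<Omega>)"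
proof (rule ex_ex1I)
  have \<alpha>M: "\<alpha> ` M = M"
    using \<alpha>(1) by (simp add: star_automorphism_def bij_betw_def)
  then have mem: "\<alpha> a \<in> M" if "a \<in> M" for a
    using imageI[OF that, of \<alpha>] by simp
  have "(\<lambda>a. \<pi> (\<alpha> a) \<Omega>) ` M = (\<lambda>a. \<pi> a \<Omega>) ` \<alpha> ` M"
    by (simp only: image_image)
  then have dense': "closure ((\<lambda>a. \<pi> (\<alpha> a) \<Omega>) ` M) = UNIV"
    using dense by (simp only: \<alpha>M)
  have "\<And>a b. a \<in> M \<Longrightarrow> b \<in> M \<Longrightarrow> \<alpha> (a o\<^sub>L b) = \<alpha> a o\<^sub>L \<alpha> b"
    "\<And>a. a \<in> M \<Longrightarrow> \<alpha> (adj a) = adj (\<alpha> a)"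
    using \<alpha>(1) unfolding star_automorphism_def star_hom_on_def by blast+
  then have "\<alpha> (adj a o\<^sub>L b) = adj (\<alpha> a) o\<^sub>L \<alpha> b" if "a \<in> M" "b \<in> M" for a b
    using that by (simp add: adj_mem)
  then have inner: "cinner (\<pi> (\<alpha> a) \<Omega>) (\<pi> (\<alpha> b) \<Omega>) = cinner (\<pi> a \<Omega>) (\<pi> b \<Omega>)" if "a \<in> M" "b \<in> M" for a b
    using that \<alpha>(2)[of "adj a o\<^sub>L b"] by (simp add: rep_cinner mem compose_mem adj_mem)
  show "\<exists>U. unitary_op U \<and> (\<forall>a\<in>M. U (\<pi> a \<Omega>) = \<pi> (\<alpha> a) \<Omega>)"
    by (rule unitary_extension[OF dense dense' inner]) blast+
next
  fix U V
  assume *: "unitary_op U \<and> (\<forall>a\<in>M. U (\<pi> a \<Omega>) = \<pi> (\<alpha> a) \<Omega>)"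
    "unitary_op V \<and> (\<forall>a\<in>M. V (\<pi> a \<Omega>) = \<pi> (\<alpha> a) \<Omega>)"
  have "U x = V x" for x
    by (rule eq_on_dense[OF dense, where f = U and g = V and x = x])
      (use * in \<open>auto intro!: linear_continuous_on blinfun.bounded_linear_right\<close>)
  then show "U = V" by (rule blinfun_eqI)
qed

text \<open>This is where traciality enters: \<tau>(a b') = \<tau>(b' a) with b' =
  \<open>adj b\<close> says exactly that taking adjoints reverses the inner product of the vectors
  a\<Omega> and b\<Omega>.\<close>

lemma modular_conj_exists:
  "\<exists>!J. antiunitary J \<and> (\<forall>a\<in>\<pi> ` M. J (blinfun_apply a \<Omega>) = adj a \<Omega>)"
proof (rule ex_ex1I)
  have "adj ` M = M"
  proof
    show "M \<subseteq> adj ` M"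
    proof
      fix a assume "a \<in> M"
      then have "a = adj (adj a)" "adj a \<in> M"
        using bounded_ops adj_mem by (auto simp: adj_adj subset_iff)
      then show "a \<in> adj ` M" by (rule image_eqI)
    qed
  qed (auto simp: adj_mem)
  moreover have "(\<lambda>a. \<pi> (adj a) \<Omega>) ` M = (\<lambda>a. \<pi> a \<Omega>) ` adj ` M"
    by (simp only: image_image)
  ultimately have dense': "closure ((\<lambda>a. \<pi> (adj a) \<Omega>) ` M) = UNIV"
    using dense by simp
  have inner: "cinner (\<pi> (adj a) \<Omega>) (\<pi> (adj b) \<Omega>) = cinner (\<pi> b \<Omega>) (\<pi> a \<Omega>)" if "a \<in> M" "b \<in> M" for a b
    using that bounded_ops trace_commute[of a "adj b"]
    by (simp add: rep_cinner adj_mem adj_adj subset_iff)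
  obtain J where "antiunitary J" "\<And>a. a \<in> M \<Longrightarrow> J (\<pi> a \<Omega>) = \<pi> (adj a) \<Omega>"
    by (rule antiunitary_extension[OF dense dense' inner]) blast+
  then show "\<exists>J. antiunitary J \<and> (\<forall>a\<in>\<pi> ` M. J (blinfun_apply a \<Omega>) = adj a \<Omega>)"
    by (auto simp: rep_adj)
next
  fix J K
  assume *: "antiunitary J \<and> (\<forall>a\<in>\<pi> ` M. J (blinfun_apply a \<Omega>) = adj a \<Omega>)"
    "antiunitary K \<and> (\<forall>a\<in>\<pi> ` M. K (blinfun_apply a \<Omega>) = adj a \<Omega>)"
  have "J x = K x" for x
    by (rule eq_on_dense[OF dense, where f = J and g = K and x = x])
      (use * in \<open>auto simp: continuous_on_antiunitary\<close>)
  then show "J = K" by (rule ext)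
qed

lemma
  shows antiunitary_modular_conj: "antiunitary (modular_conj (\<pi> ` M) \<Omega>)"
    and modular_conj_rep: "a \<in> M \<Longrightarrow> modular_conj (\<pi> ` M) \<Omega> (\<pi> a \<Omega>) = \<pi> (adj a) \<Omega>"
  using theI'[OF modular_conj_exists] by (auto simp: modular_conj_def rep_adj)

text \<open>\<open>J\<close> maps N\<Omega> into itself because \<open>N\<close> is closed under
  adjoints. Pairing c\<Omega> with the right translate of \<open>x\<close> by \<open>f\<close> can
  thus be rewritten, by moving \<open>J\<close> and \<open>f\<close> to the other side, as a pairing
  of \<open>x\<close> with another vector of N\<Omega>, which is 0.\<close>

lemma right_submodule_ocompl:
  assumes "N \<subseteq> M" and comp: "\<And>a b. a \<in> N \<Longrightarrow> b \<in> N \<Longrightarrow> a o\<^sub>L b \<in> N"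
    and adj: "\<And>a. a \<in> N \<Longrightarrow> adj a \<in> N"
  shows "right_submodule (\<pi> ` M) (\<pi> ` N) \<Omega> (ocompl (cyclic_space (\<pi> ` N) \<Omega>))"
proof -
  define J where "J = modular_conj (\<pi> ` M) \<Omega>"
  have J: "cinner (J x) (J y) = cinner y x" for x y
    using antiunitary_modular_conj by (simp add: J_def antiunitary_def)
  have J_rep: "\<pi> (adj a) \<Omega> = J (\<pi> a \<Omega>)" if "a \<in> N" for a
    using that \<open>N \<subseteq> M\<close> by (auto simp: J_def modular_conj_rep)
  have "right_act (\<pi> ` M) \<Omega> x (\<pi> f) \<in> ocompl ((\<lambda>a. blinfun_apply a \<Omega>) ` \<pi> ` N)"
    if x: "x \<in> ocompl ((\<lambda>a. blinfun_apply a \<Omega>) ` \<pi> ` N)" and f: "f \<in> N" for x f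
  proof -
    have "cinner (\<pi> c \<Omega>) (J (adj (\<pi> f) (J x))) = 0" if c: "c \<in> N" for c
    proof -
      have ops: "c \<in> bounded_ops" "\<pi> f \<in> bounded_ops"
        using c f \<open>N \<subseteq> M\<close> bounded_ops image_bounded_ops by auto
      have "\<pi> c \<Omega> = J (\<pi> (adj c) \<Omega>)"
        using J_rep[OF adj[OF c]] ops by (simp add: adj_adj)
      then have "cinner (\<pi> c \<Omega>) (J (adj (\<pi> f) (J x))) = cinner (J x) (\<pi> f (\<pi> (adj c) \<Omega>))"
        using ops by (simp add: J adj_works)
      also have "\<pi> f (\<pi> (adj c) \<Omega>) = \<pi> (f o\<^sub>L adj c) \<Omega>"
        using f c \<open>N \<subseteq> M\<close> adj by (subst rep_compose) auto
      also have "\<dots> = J (\<pi> (adj (f o\<^sub>L adj c)) \<Omega>)"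
        using f c adj comp \<open>N \<subseteq> M\<close> bounded_ops J_rep[of "adj (f o\<^sub>L adj c)"]
        by (metis adj_adj subsetD)
      also have "cinner (J x) \<dots> = 0"
        using x f c adj comp by (auto simp: J ocompl_def)
      finally show ?thesis .
    qed
    then show ?thesis
      by (auto simp: ocompl_def right_act_def J_def)
  qed
  then show ?thesis
    by (auto simp: right_submodule_def csubspace_ocompl closed_ocompl cyclic_space_def ocompl_closure)
qed

end

text \<open>Both halves of the hypothesis are used: \<open>S\<close> inside its image keeps
  \<open>U x\<close> orthogonal to \<open>S\<close>, and the image inside \<open>S\<close> does the
  same for preimages.\<close>

lemma unitary_image_ocompl:
  assumes "unitary_op U" and "blinfun_apply U ` S = S"
  shows "blinfun_apply U ` ocompl S = ocompl S"
proof
  show "blinfun_apply U ` ocompl S \<subseteq> ocompl S"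
  proof clarify
    fix x assume x: "x \<in> ocompl S"
    have "cinner s (U x) = 0" if s: "s \<in> S" for s
    proof -
      obtain t where "t \<in> S" "s = U t" using s assms(2) by blast
      then show ?thesis using x assms(1) by (simp add: ocompl_def unitary_cinner)
    qed
    then show "U x \<in> ocompl S" by (simp add: ocompl_def)
  qed
  show "ocompl S \<subseteq> blinfun_apply U ` ocompl S"
  proof
    fix y assume y: "y \<in> ocompl S"
    obtain x where x: "y = U x" using unitary_surj[OF assms(1)] by blast
    have "cinner s x = 0" if "s \<in> S" for s
      using y that assms unfolding x ocompl_def by (metis (mono_tags, lifting) image_eqI mem_Collect_eq unitary_cinner)
    then show "y \<in> blinfun_apply U ` ocompl S" by (auto simp: x ocompl_def)
  qed
qed

section \<open>Matrices over an operator algebra\<close>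

definition matrix_unit :: "'n \<Rightarrow> 'n \<Rightarrow> complex ^ 'n ^ 'n::finite"
  where "matrix_unit i j = (\<chi> k l. if k = i \<and> l = j then 1 else 0)"

definition conj_transpose :: "complex ^ 'n ^ 'n \<Rightarrow> complex ^ 'n ^ 'n::finite"
  where "conj_transpose m = (\<chi> i j. cnj (m $ j $ i))"

lemma scaleC_matrix_nth [simp]: "(c *\<^sub>C m) $ i $ j = c * m $ i $ j"
  for m :: "complex ^ 'n ^ 'm"
  by (simp add: scaleC_vec_def scaleC_complex_def)

lemma matrix_unit_expansion: "m = (\<Sum>i\<in>UNIV. \<Sum>j\<in>UNIV. (m $ i $ j) *\<^sub>C matrix_unit i j)"
proof -
  have "(\<Sum>i\<in>UNIV. \<Sum>j\<in>UNIV. m $ i $ j * (if k = i \<and> l = j then 1 else 0)) = m $ k $ l" for k l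
  proof -
    have "(\<Sum>j\<in>UNIV. m $ i $ j * (if k = i \<and> l = j then 1 else 0)) = (if k = i then m $ i $ l else 0)" for i
      by (cases "k = i") (simp_all add: if_distrib cong: if_cong)
    then show ?thesis by simp
  qed
  then show ?thesis
    by (simp add: vec_eq_iff matrix_unit_def)
qed

lemma matrix_unit_mult: "matrix_unit i j ** matrix_unit k l = (if j = k then matrix_unit i l else 0)"
proof -
  have "(\<Sum>x\<in>UNIV. (if a = i \<and> x = j then 1 else 0) * (if x = k \<and> b = l then 1 else 0) :: complex)
      = (if j = k \<and> a = i \<and> b = l then 1 else 0)" for a b
  proof -
    have "(if a = i \<and> x = j then 1 else 0) * (if x = k \<and> b = l then 1 else 0 :: complex)
        = (if x = j then (if j = k \<and> a = i \<and> b = l then 1 else 0) else 0)" for x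
      by auto
    then show ?thesis by simp
  qed
  then show ?thesis
    by (auto simp: vec_eq_iff matrix_unit_def matrix_matrix_mult_def)
qed

lemma trace_matrix_unit_mult: "trace (matrix_unit j i ** m) = m $ i $ j"
proof -
  have "(\<Sum>x\<in>UNIV. (if k = j \<and> x = i then 1 else 0) * m $ x $ k) = (if k = j then m $ i $ j else 0)" for k
    by (cases "k = j") (simp_all add: if_distrib[of "\<lambda>z. z * _"] cong: if_cong)
  then show ?thesis
    by (simp add: trace_def matrix_matrix_mult_def matrix_unit_def)
qed

lemma
  fixes f :: "'a::complex_hilbert_space \<Rightarrow> 'b::complex_hilbert_space"
  assumes f: "clinear_on UNIV f"
  shows clinear_on_zero: "f 0 = 0"
    and clinear_on_sum: "f (sum g S) = (\<Sum>i\<in>S. f (g i))"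
proof -
  have "f (0 *\<^sub>C 0) = 0 *\<^sub>C f 0"
    using f unfolding clinear_on_def by blast
  then show zero: "f 0 = 0" by simp
  have "f (x + y) = f x + f y" for x y
    using f unfolding clinear_on_def by blast
  then show "f (sum g S) = (\<Sum>i\<in>S. f (g i))"
    by (induction S rule: infinite_finite_induct) (simp_all add: zero)
qed

lemma clinear_matrix_expansion:
  fixes f :: "complex ^ 'n ^ 'n \<Rightarrow> 'h::complex_hilbert_space"
  assumes f: "clinear_on UNIV f"
  shows "f m = (\<Sum>i\<in>UNIV. \<Sum>j\<in>UNIV. (m $ i $ j) *\<^sub>C f (matrix_unit i j))"
proof -
  have scale: "f (c *\<^sub>C x) = c *\<^sub>C f x" for c x
    using f unfolding clinear_on_def by blast
  have "f m = f (\<Sum>i\<in>UNIV. \<Sum>j\<in>UNIV. (m $ i $ j) *\<^sub>C matrix_unit i j)"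
    by (rule arg_cong[OF matrix_unit_expansion])
  then show ?thesis
    by (simp only: clinear_on_sum[OF f] scale)
qed

text \<open>Swapping the factors of \<open>e_ij = e_ik e_kj\<close> gives \<open>e_kk\<close> if i =
  j and 0 otherwise, so \<open>s\<close> is determined by its value \<open>t\<close> on one diagonal
  unit. \<open>CARD('n)\<close> is the trace of the identity; it trades \<open>t\<close> for
  \<open>s (mat 1)\<close>.\<close>

lemma trace_unique:
  fixes s :: "complex ^ 'n ^ 'n \<Rightarrow> complex"
  assumes s: "clinear_on UNIV s" and commute: "\<And>m k. s (m ** k) = s (k ** m)"
  shows "of_nat CARD('n) * s m = trace m * s (mat 1)"
proof -
  fix k :: 'n
  define t where "t = s (matrix_unit k k)"
  have unit: "s (matrix_unit i j) = (if i = j then t else 0)" for i j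
    using clinear_on_zero[OF s] commute[of "matrix_unit i k" "matrix_unit k j"] by (auto simp: matrix_unit_mult t_def)
  have s_eq: "s m = trace m * t" for m
  proof -
    have "s m = (\<Sum>i\<in>UNIV. \<Sum>j\<in>UNIV. m $ i $ j * s (matrix_unit i j))"
      using clinear_matrix_expansion[OF s, of m] by (simp add: scaleC_complex_def)
    also have "\<dots> = trace m * t"
      by (simp add: unit if_distrib trace_def sum_distrib_right cong: if_cong)
    finally show ?thesis .
  qed
  show ?thesis
    by (simp add: s_eq[of m] s_eq[of "mat 1"] trace_I)
qed

section \<open>Algebra of elementary tensors\<close>

lemma tensor_op_nth: "tensor_op b m v $ i = (\<Sum>j\<in>UNIV. (m $ i $ j) *\<^sub>C b (v $ j))"
  by (simp add: tensor_op.rep_eq)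

text \<open>Elements of the operator type are only real-linear. Complex linearity of
  \<open>b\<close> is what lets the entries of \<open>k\<close> pass through it.\<close>

lemma tensor_op_compose:
  assumes "b \<in> bounded_ops"
  shows "tensor_op b m o\<^sub>L tensor_op c k = tensor_op (b o\<^sub>L c) (m ** k)"
proof -
  have "(\<Sum>j\<in>UNIV. (m $ i $ j) *\<^sub>C b (\<Sum>l\<in>UNIV. (k $ j $ l) *\<^sub>C c (v $ l)))
      = (\<Sum>l\<in>UNIV. (\<Sum>j\<in>UNIV. m $ i $ j * k $ j $ l) *\<^sub>C b (c (v $ l)))" for v i
  proof -
    have "(\<Sum>j\<in>UNIV. (m $ i $ j) *\<^sub>C b (\<Sum>l\<in>UNIV. (k $ j $ l) *\<^sub>C c (v $ l)))
        = (\<Sum>j\<in>UNIV. \<Sum>l\<in>UNIV. (m $ i $ j * k $ j $ l) *\<^sub>C b (c (v $ l)))"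
      using assms by (simp add: blinfun.sum_right scaleC_sum_right bounded_ops_def scaleC_scaleC)
    also have "\<dots> = (\<Sum>l\<in>UNIV. \<Sum>j\<in>UNIV. (m $ i $ j * k $ j $ l) *\<^sub>C b (c (v $ l)))"
      by (rule sum.swap)
    finally show ?thesis by (simp add: scaleC_sum_left)
  qed
  then show ?thesis
    by (auto intro!: blinfun_eqI simp: vec_eq_iff tensor_op_nth matrix_matrix_mult_def)
qed

lemma tensor_op_add_right: "tensor_op b (m + k) = tensor_op b m + tensor_op b k"
  by (auto intro!: blinfun_eqI
      simp: vec_eq_iff tensor_op_nth blinfun.add_left scaleC_add_left sum.distrib)

lemma tensor_op_scaleC_right: "tensor_op b (c *\<^sub>C m) = c *\<^sub>C tensor_op b m"
  by (auto intro!: blinfun_eqI simp: vec_eq_iff tensor_op_nth scaleC_blinfun.rep_eq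
      scaleC_vec_def[of c "tensor_op b m _"] scaleC_sum_right scaleC_scaleC)

lemma tensor_op_zero_right: "tensor_op b 0 = 0"
  by (auto intro!: blinfun_eqI simp: vec_eq_iff tensor_op_nth)

lemma tensor_op_add_left: "tensor_op (b + c) m = tensor_op b m + tensor_op c m"
  by (auto intro!: blinfun_eqI
      simp: vec_eq_iff tensor_op_nth blinfun.add_left scaleC_add_right sum.distrib)

lemma tensor_op_scaleC_left: "tensor_op (c *\<^sub>C b) m = c *\<^sub>C tensor_op b m"
  by (auto intro!: blinfun_eqI simp: vec_eq_iff tensor_op_nth scaleC_blinfun.rep_eq
      scaleC_vec_def[of c "tensor_op b m _"] scaleC_sum_right scaleC_scaleC mult.commute)

lemma tensor_op_bounded_ops: "b \<in> bounded_ops \<Longrightarrow> tensor_op b m \<in> bounded_ops"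
  by (auto simp: bounded_ops_def vec_eq_iff tensor_op_nth scaleC_vec_def
      scaleC_sum_right scaleC_scaleC mult.commute)

lemma adj_tensor_op:
  assumes "b \<in> bounded_ops"
  shows "adj (tensor_op b m) = tensor_op (adj b) (conj_transpose m)"
proof (rule adj_eqI)
  fix x y :: "'a ^ 'b"
  have "cinner (tensor_op (adj b) (conj_transpose m) x) y
      = (\<Sum>i\<in>UNIV. \<Sum>j\<in>UNIV. m $ j $ i * cinner (x $ j) (b (y $ i)))"
    by (simp add: cinner_vec_def tensor_op_nth cinner_sum_left cinner_scaleC_left
        conj_transpose_def adj_works[OF assms])
  also have "\<dots> = (\<Sum>j\<in>UNIV. \<Sum>i\<in>UNIV. m $ j $ i * cinner (x $ j) (b (y $ i)))"
    by (rule sum.swap)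
  also have "\<dots> = cinner x (tensor_op b m y)"
    by (simp add: cinner_vec_def tensor_op_nth cinner_sum_right cinner_scaleC_right)
  finally show "cinner (tensor_op (adj b) (conj_transpose m) x) y = cinner x (tensor_op b m y)" .
qed

lemma conj_transpose_mat: "conj_transpose (mat 1) = mat 1"
  by (auto simp: conj_transpose_def mat_def vec_eq_iff)

section \<open>The algebra spanned by the elementary tensors\<close>

lemma csubspace_hull: "csubspace (csubspace hull S)"
  by (rule hull_in) (auto simp: csubspace_def)

lemma csubspace_matrix_algebra: "csubspace (matrix_algebra B)"
  unfolding matrix_algebra_def by (rule csubspace_hull)

lemma tensor_op_mem: "b \<in> B \<Longrightarrow> tensor_op b m \<in> matrix_algebra B"
  unfolding matrix_algebra_def by (rule hull_inc) blast

lemma matrix_algebra_add: "x \<in> matrix_algebra B \<Longrightarrow> y \<in> matrix_algebra B \<Longrightarrow> x + y \<in> matrix_algebra B"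
  and matrix_algebra_scaleC: "x \<in> matrix_algebra B \<Longrightarrow> c *\<^sub>C x \<in> matrix_algebra B"
  using csubspace_matrix_algebra[of B] by (auto simp: csubspace_def)

text \<open>There is no case for 0: it is the elementary tensor of any \<open>b\<close> with the
  zero matrix, which is why \<open>B\<close> has to be nonempty. The hull induction runs on
  membership together with \<open>P\<close>, so that the sum and scalar cases may assume
  membership.\<close>

lemma matrix_algebra_induct [consumes 2, case_names tensor add scaleC]:
  fixes B :: "('k::complex_hilbert_space \<Rightarrow>\<^sub>L 'k) set" and x :: "('k ^ 'n::finite) \<Rightarrow>\<^sub>L ('k ^ 'n)"
  assumes "B \<noteq> {}" and x: "x \<in> matrix_algebra B"
    and tensor: "\<And>b m. b \<in> B \<Longrightarrow> P (tensor_op b m)"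
    and add: "\<And>x y. x \<in> matrix_algebra B \<Longrightarrow> y \<in> matrix_algebra B \<Longrightarrow> P x \<Longrightarrow> P y \<Longrightarrow> P (x + y)"
    and scaleC: "\<And>c x. x \<in> matrix_algebra B \<Longrightarrow> P x \<Longrightarrow> P (c *\<^sub>C x)"
  shows "P x"
proof -
  obtain b where "b \<in> B" using \<open>B \<noteq> {}\<close> by blast
  then have "0 \<in> matrix_algebra B" "P 0"
    using tensor[of b 0] tensor_op_mem[of b B 0] by (simp_all add: tensor_op_zero_right)
  then have sub: "csubspace {x. x \<in> matrix_algebra B \<and> P x}"
    unfolding csubspace_def mem_Collect_eq
    by (simp add: add scaleC matrix_algebra_add matrix_algebra_scaleC)
  have "x \<in> matrix_algebra B \<and> P x"
    using x unfolding matrix_algebra_def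
  proof (rule hull_induct)
    show "csubspace {x. x \<in> csubspace hull {tensor_op b m | b m. b \<in> B} \<and> P x}"
      using sub unfolding matrix_algebra_def .
    fix y :: "('k ^ 'n) \<Rightarrow>\<^sub>L ('k ^ 'n)"
    assume "y \<in> {tensor_op b m | b m. b \<in> B}"
    then obtain b and m :: "complex ^ 'n ^ 'n" where "y = tensor_op b m" "b \<in> B" by blast
    then show "y \<in> csubspace hull {tensor_op b m | b m. b \<in> B} \<and> P y"
      using tensor[of b m] tensor_op_mem[of b B m] by (simp only: matrix_algebra_def)
  qed
  then show ?thesis by (rule conjunct2)
qed

lemma adj_add: "S \<in> bounded_ops \<Longrightarrow> T \<in> bounded_ops \<Longrightarrow> adj (S + T) = adj S + adj T"
  by (rule adj_eqI) (simp add: blinfun.add_left cinner_add_left cinner_add_right adj_works)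

lemma adj_scaleC: "T \<in> bounded_ops \<Longrightarrow> adj (c *\<^sub>C T) = cnj c *\<^sub>C adj T"
  by (rule adj_eqI) (simp add: scaleC_blinfun.rep_eq cinner_scaleC_left cinner_scaleC_right adj_works)

lemma compose_id: "T o\<^sub>L id_blinfun = T" "id_blinfun o\<^sub>L T = T"
  by (auto intro!: blinfun_eqI)

lemma compose_add_left: "(S + T) o\<^sub>L R = (S o\<^sub>L R) + (T o\<^sub>L R)"
  and compose_add_right: "R o\<^sub>L (S + T) = (R o\<^sub>L S) + (R o\<^sub>L T)"
  by (auto intro!: blinfun_eqI simp: blinfun.add_left blinfun.add_right)

lemma compose_scaleC_left: "(c *\<^sub>C T) o\<^sub>L R = c *\<^sub>C (T o\<^sub>L R)"
  by (auto intro!: blinfun_eqI simp: scaleC_blinfun.rep_eq)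

lemma compose_scaleC_right: "R \<in> bounded_ops \<Longrightarrow> R o\<^sub>L (c *\<^sub>C T) = c *\<^sub>C (R o\<^sub>L T)"
  by (auto intro!: blinfun_eqI simp: scaleC_blinfun.rep_eq bounded_ops_def)

context
  fixes B :: "('k::complex_hilbert_space \<Rightarrow>\<^sub>L 'k) set"
  assumes vna: "von_neumann_algebra B"
begin

lemma von_neumann_algebra_nonempty: "B \<noteq> {}"
  using vna_id[OF vna] by blast

lemma matrix_algebra_bounded_ops: "matrix_algebra B \<subseteq> bounded_ops"
proof
  fix x :: "('k ^ 'n) \<Rightarrow>\<^sub>L ('k ^ 'n)"
  assume "x \<in> matrix_algebra B"
  with von_neumann_algebra_nonempty show "x \<in> bounded_ops"
  proof (induction rule: matrix_algebra_induct)
    case (tensor b m)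
    then show ?case using vna_bounded_ops[OF vna] by (auto intro: tensor_op_bounded_ops)
  next
    case (add x y)
    then show ?case by (simp add: bounded_ops_def blinfun.add_left scaleC_add_right)
  next
    case (scaleC c x)
    then show ?case by (simp add: bounded_ops_def scaleC_blinfun.rep_eq scaleC_scaleC mult.commute)
  qed
qed

lemma matrix_algebra_compose:
  assumes x: "x \<in> matrix_algebra B" and y: "y \<in> matrix_algebra B"
  shows "x o\<^sub>L y \<in> matrix_algebra B"
  using von_neumann_algebra_nonempty x
proof (induction rule: matrix_algebra_induct)
  case (tensor b m)
  then have b: "b \<in> bounded_ops" using vna_bounded_ops[OF vna] by blast
  from von_neumann_algebra_nonempty y show ?case
  proof (induction rule: matrix_algebra_induct)
    case (tensor c k)
    then show ?case
      using b \<open>b \<in> B\<close> by (simp add: tensor_op_compose tensor_op_mem vna_compose[OF vna])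
  qed (simp_all add: compose_add_right compose_scaleC_right tensor_op_bounded_ops b
      matrix_algebra_add matrix_algebra_scaleC)
qed (simp_all add: compose_add_left compose_scaleC_left matrix_algebra_add matrix_algebra_scaleC)

lemma matrix_algebra_adj:
  assumes x: "x \<in> matrix_algebra B"
  shows "adj x \<in> matrix_algebra B"
  using von_neumann_algebra_nonempty x
proof (induction rule: matrix_algebra_induct)
  case (tensor b m)
  then show ?case
    using vna_bounded_ops[OF vna] by (subst adj_tensor_op) (auto intro: tensor_op_mem vna_adj[OF vna])
next
  case (add x y)
  then show ?case
    by (simp add: adj_add subsetD[OF matrix_algebra_bounded_ops] matrix_algebra_add)
next
  case (scaleC c x)
  then show ?case
    by (simp add: adj_scaleC subsetD[OF matrix_algebra_bounded_ops] matrix_algebra_scaleC)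
qed

text \<open>Bilinearity reduces the claim to elementary tensors, where it combines the trace
  properties of \<nu> and of the matrix trace. In the main theorem \<mu> is given by linearity and
  its values on such tensors, so its traciality has to be derived.\<close>

lemma matrix_algebra_trace_commute:
  fixes \<tau> :: "(('k ^ 'n::finite) \<Rightarrow>\<^sub>L ('k ^ 'n)) \<Rightarrow> complex"
  assumes lin: "clinear_on (matrix_algebra B) \<tau>"
    and \<tau>: "\<And>b m. b \<in> B \<Longrightarrow> \<tau> (tensor_op b m) = \<nu> b * (trace m / of_nat CARD('n))"
    and \<nu>: "\<And>b c. b \<in> B \<Longrightarrow> c \<in> B \<Longrightarrow> \<nu> (b o\<^sub>L c) = \<nu> (c o\<^sub>L b)"
    and x: "x \<in> matrix_algebra B" and y: "y \<in> matrix_algebra B"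
  shows "\<tau> (x o\<^sub>L y) = \<tau> (y o\<^sub>L x)"
proof -
  have \<tau>_add: "\<And>u v. u \<in> matrix_algebra B \<Longrightarrow> v \<in> matrix_algebra B \<Longrightarrow> \<tau> (u + v) = \<tau> u + \<tau> v"
    and \<tau>_scale: "\<And>c u. u \<in> matrix_algebra B \<Longrightarrow> \<tau> (c *\<^sub>C u) = c * \<tau> u"
    using lin by (simp_all add: clinear_on_def scaleC_complex_def)
  have ops: "u \<in> bounded_ops" if "u \<in> matrix_algebra B" for u :: "('k ^ 'n) \<Rightarrow>\<^sub>L ('k ^ 'n)"
    using that matrix_algebra_bounded_ops by blast
  note simps = compose_add_left compose_add_right compose_scaleC_left compose_scaleC_right
    \<tau>_add \<tau>_scale matrix_algebra_compose ops tensor_op_mem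
  from von_neumann_algebra_nonempty x show ?thesis
  proof (induction rule: matrix_algebra_induct)
    case (tensor b m)
    from von_neumann_algebra_nonempty y show ?case
    proof (induction rule: matrix_algebra_induct)
      case (tensor c k)
      then have "b \<in> bounded_ops" "c \<in> bounded_ops"
        using vna_bounded_ops[OF vna] \<open>b \<in> B\<close> by auto
      then show ?case
        using \<open>b \<in> B\<close> \<open>c \<in> B\<close> \<nu>[of b c] trace_mul_sym[of m k]
        by (simp add: tensor_op_compose \<tau> vna_compose[OF vna])
    qed (use tensor in \<open>simp_all add: simps\<close>)
  qed (use y in \<open>simp_all add: simps\<close>)
qed

lemma matrix_algebra_trace_invariant:
  fixes \<tau> :: "(('k ^ 'n::finite) \<Rightarrow>\<^sub>L ('k ^ 'n)) \<Rightarrow> complex"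
  assumes lin: "clinear_on (matrix_algebra B) \<tau>"
    and \<tau>: "\<And>b m. b \<in> B \<Longrightarrow> \<tau> (tensor_op b m) = \<nu> b * (trace m / of_nat CARD('n))"
    and commute: "\<And>x y. x \<in> matrix_algebra B \<Longrightarrow> y \<in> matrix_algebra B \<Longrightarrow> \<tau> (x o\<^sub>L y) = \<tau> (y o\<^sub>L x)"
    and \<alpha>: "star_automorphism (matrix_algebra B) \<alpha>"
    and \<alpha>_tensor: "\<And>b. b \<in> B \<Longrightarrow> \<alpha> (tensor_op b (mat 1)) = tensor_op (\<beta> b) (mat 1)"
    and \<beta>: "\<And>b. b \<in> B \<Longrightarrow> \<beta> b \<in> B" "\<And>b. b \<in> B \<Longrightarrow> \<nu> (\<beta> b) = \<nu> b"
    and x: "x \<in> matrix_algebra B"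
  shows "\<tau> (\<alpha> x) = \<tau> x"
proof -
  have \<tau>_add: "\<And>u v. u \<in> matrix_algebra B \<Longrightarrow> v \<in> matrix_algebra B \<Longrightarrow> \<tau> (u + v) = \<tau> u + \<tau> v"
    and \<tau>_scale: "\<And>c u. u \<in> matrix_algebra B \<Longrightarrow> \<tau> (c *\<^sub>C u) = c * \<tau> u"
    using lin by (simp_all add: clinear_on_def scaleC_complex_def)
  have \<alpha>_add: "\<And>u v. u \<in> matrix_algebra B \<Longrightarrow> v \<in> matrix_algebra B \<Longrightarrow> \<alpha> (u + v) = \<alpha> u + \<alpha> v"
    and \<alpha>_scale: "\<And>c u. u \<in> matrix_algebra B \<Longrightarrow> \<alpha> (c *\<^sub>C u) = c *\<^sub>C \<alpha> u"
    and \<alpha>_compose: "\<And>u v. u \<in> matrix_algebra B \<Longrightarrow> v \<in> matrix_algebra B \<Longrightarrow> \<alpha> (u o\<^sub>L v) = \<alpha> u o\<^sub>L \<alpha> v"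
    and \<alpha>_mem: "\<And>u. u \<in> matrix_algebra B \<Longrightarrow> \<alpha> u \<in> matrix_algebra B"
    using \<alpha> unfolding star_automorphism_def star_hom_on_def clinear_on_def bij_betw_def by blast+
  from von_neumann_algebra_nonempty x show ?thesis
  proof (induction rule: matrix_algebra_induct)
    case (tensor b m)
    define s where "s m = \<tau> (\<alpha> (tensor_op b m))" for m :: "complex ^ 'n ^ 'n"
    have mem: "tensor_op b k \<in> matrix_algebra B" for k :: "complex ^ 'n ^ 'n"
      using tensor by (rule tensor_op_mem)
    have "clinear_on UNIV s"
      by (simp add: clinear_on_def s_def tensor_op_add_right tensor_op_scaleC_right
          \<alpha>_add \<alpha>_scale \<tau>_add \<tau>_scale mem \<alpha>_mem scaleC_complex_def)
    \<comment> \<open>Since 1 \<otimes> k commutes with b \<otimes> 1, the tensors b \<otimes> mk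
      and b \<otimes> km are the two products of b \<otimes> m and 1 \<otimes> k. Multiplicativity
      of \<alpha> and traciality of \<tau> then give equal values.\<close>
    moreover have "s (m ** k) = s (k ** m)" for m k
    proof -
      have id: "tensor_op id_blinfun k \<in> matrix_algebra B"
        using vna_id[OF vna] by (rule tensor_op_mem)
      have "b \<in> bounded_ops" "(id_blinfun :: 'k \<Rightarrow>\<^sub>L 'k) \<in> bounded_ops"
        using tensor vna_id[OF vna] vna_bounded_ops[OF vna] by auto
      then have "tensor_op b (m ** k) = tensor_op b m o\<^sub>L tensor_op id_blinfun k"
        "tensor_op b (k ** m) = tensor_op id_blinfun k o\<^sub>L tensor_op b m"
        by (simp_all add: tensor_op_compose compose_id)
      then show ?thesis
        using commute[OF \<alpha>_mem[OF mem] \<alpha>_mem[OF id]] by (simp add: s_def \<alpha>_compose mem id)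
    qed
    ultimately have "of_nat CARD('n) * s m = trace m * s (mat 1)"
      by (rule trace_unique)
    \<comment> \<open>At the unit matrix \<alpha> is known, and \<beta>-invariance of \<nu> fixes
      the multiple.\<close>
    also have "s (mat 1) = \<nu> b"
      using tensor by (simp add: s_def \<alpha>_tensor \<beta> \<tau> trace_I)
    finally show ?case
      using tensor by (simp add: s_def \<tau> field_simps)
  next
    case (add x y)
    then show ?case by (simp add: \<alpha>_add \<alpha>_mem \<tau>_add)
  next
    case (scaleC c x)
    then show ?case by (simp add: \<alpha>_scale \<alpha>_mem \<tau>_scale)
  qed
qed

end

section \<open>Discrete spectrum\<close>

text \<open>The hull is squeezed: every module lies in the complement, a closed subspace, and the
  complement is itself one of the modules.\<close>

lemma discrete_part_eq_ocompl:
  assumes "finite_module M N \<Omega> U w (ocompl (cyclic_space N \<Omega>))"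
  shows "discrete_part M N \<Omega> U w = ocompl (cyclic_space N \<Omega>)"
  unfolding discrete_part_def
proof (rule subset_antisym)
  show "(\<lambda>V. csubspace V \<and> closed V) hull \<Union> {V. finite_module M N \<Omega> U w V}
      \<subseteq> ocompl (cyclic_space N \<Omega>)"
    by (rule hull_minimal) (auto simp: finite_module_def csubspace_ocompl closed_ocompl)
  have "ocompl (cyclic_space N \<Omega>) \<subseteq> \<Union> {V. finite_module M N \<Omega> U w V}"
    using assms by blast
  also have "\<dots> \<subseteq> (\<lambda>V. csubspace V \<and> closed V) hull \<Union> {V. finite_module M N \<Omega> U w V}"
    by (rule hull_subset)
  finally show "ocompl (cyclic_space N \<Omega>)
      \<subseteq> (\<lambda>V. csubspace V \<and> closed V) hull \<Union> {V. finite_module M N \<Omega> U w V}" .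
qed

lemma finite_weight_proj_ocompl:
  fixes w :: "('h::complex_hilbert_space \<Rightarrow>\<^sub>L 'h) \<Rightarrow> ennreal"
  assumes w: "faithful_normal_semifinite_tracial_weight (basic_construction M N \<Omega>) w"
    and fin: "w id_blinfun < \<infinity>" and V: "csubspace (cyclic_space N \<Omega>)"
  shows "w (proj (ocompl (cyclic_space N \<Omega>))) < \<infinity>"
proof -
  define e where "e = proj (cyclic_space N \<Omega>)"
  have closed: "closed (cyclic_space N \<Omega>)"
    by (simp add: cyclic_space_def)
  have compl: "proj (ocompl (cyclic_space N \<Omega>)) = id_blinfun - e"
    unfolding e_def by (rule proj_ocompl[OF V closed])
  have e: "e \<in> pos_part (basic_construction M N \<Omega>)"
    using positive_proj[OF V closed]
    by (simp add: pos_part_def basic_construction_def jones_projection_def hull_inc flip: e_def)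
  \<comment> \<open>The hull is an intersection, so membership is checked in each von Neumann
    algebra containing the generators.\<close>
  have e': "id_blinfun - e \<in> pos_part (basic_construction M N \<Omega>)"
    using positive_proj[OF csubspace_ocompl closed_ocompl, of "cyclic_space N \<Omega>"]
    by (auto simp: pos_part_def basic_construction_def jones_projection_def hull_def compl
        intro!: vna_diff vna_id simp flip: e_def)
  have "\<forall>x\<in>pos_part (basic_construction M N \<Omega>). \<forall>y\<in>pos_part (basic_construction M N \<Omega>).
      w (x + y) = w x + w y"
    using w unfolding faithful_normal_semifinite_tracial_weight_def by (rule conjunct1)
  from this[rule_format, OF e e'] have "w id_blinfun = w e + w (id_blinfun - e)"
    by simp
  then have "w (id_blinfun - e) \<le> w id_blinfun"
    by simp
  then show ?thesis
    unfolding compl using fin by (rule order_le_less_trans)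
qed

theorem proposition5p6:
  fixes B :: "'k::complex_hilbert_space sys"
    and A F :: "('k ^ 'n::finite) sys"
    and \<pi> :: "(('k ^ 'n) \<Rightarrow>\<^sub>L ('k ^ 'n)) \<Rightarrow> ('h::complex_hilbert_space \<Rightarrow>\<^sub>L 'h)"
    and \<Omega> :: 'h
    and \<mu>bar :: "('h \<Rightarrow>\<^sub>L 'h) \<Rightarrow> ennreal"
  assumes "is_system B"
    and "alg A = matrix_algebra (alg B)"
    and "clinear_on (alg A) (tr A)"
    and "\<And>b m. b \<in> alg B \<Longrightarrow> tr A (tensor_op b m) = tr B b * (trace m / of_nat CARD('n))"
    and "star_automorphism (alg A) (dyn A)"
    and "\<And>b. b \<in> alg B \<Longrightarrow> dyn A (tensor_op b (mat 1)) = tensor_op (dyn B b) (mat 1)"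
    and "alg F = (\<lambda>b. tensor_op b (mat 1)) ` alg B"
    and "\<And>b. b \<in> alg B \<Longrightarrow> tr F (tensor_op b (mat 1)) = tr B b"
    and "\<And>b. b \<in> alg B \<Longrightarrow> dyn F (tensor_op b (mat 1)) = tensor_op (dyn B b) (mat 1)"
    and "gns_representation A \<pi> \<Omega>"
    and "canonical_trace (\<pi> ` alg A) (\<pi> ` alg F) \<Omega> \<mu>bar"
  shows "relative_discrete_spectrum A F \<pi> \<Omega> \<mu>bar"
proof -
  have vna: "von_neumann_algebra (alg B)" and \<beta>: "dyn B ` alg B = alg B"
    and trB: "\<And>b c. b \<in> alg B \<Longrightarrow> c \<in> alg B \<Longrightarrow> tr B (b o\<^sub>L c) = tr B (c o\<^sub>L b)"
      "\<And>b. b \<in> alg B \<Longrightarrow> tr B (dyn B b) = tr B b"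
    using assms(1)
    by (auto simp: is_system_def faithful_normal_trace_def star_automorphism_def bij_betw_def)
  have \<beta>_mem: "dyn B b \<in> alg B" if "b \<in> alg B" for b
    using imageI[OF that, of "dyn B"] \<beta> by simp
  have ops: "b \<in> bounded_ops" if "b \<in> alg B" for b
    using vna_bounded_ops[OF vna] that by blast
  have mem: "tensor_op b m \<in> alg A" if "b \<in> alg B" for b and m :: "complex ^ 'n ^ 'n"
    using that by (simp add: assms(2) tensor_op_mem)
  have trA: "tr A (x o\<^sub>L y) = tr A (y o\<^sub>L x)" if "x \<in> alg A" "y \<in> alg A" for x y
    using matrix_algebra_trace_commute[OF vna assms(3)[unfolded assms(2)] assms(4) trB(1)] that
    by (simp add: assms(2))
  have inv: "tr A (dyn A x) = tr A x" if "x \<in> alg A" for x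
    using matrix_algebra_trace_invariant[OF vna assms(3)[unfolded assms(2)] assms(4)
        trA[unfolded assms(2)] assms(5)[unfolded assms(2)] assms(6) \<beta>_mem trB(2)] that
    by (simp add: assms(2))
  interpret tracial_gns "alg A" "tr A" \<pi> \<Omega>
  proof
    show "alg A \<subseteq> bounded_ops"
      unfolding assms(2) by (rule matrix_algebra_bounded_ops[OF vna])
    show "a o\<^sub>L b \<in> alg A" if "a \<in> alg A" "b \<in> alg A" for a b
      using that unfolding assms(2) by (rule matrix_algebra_compose[OF vna])
    show "adj a \<in> alg A" if "a \<in> alg A" for a
      using that unfolding assms(2) by (rule matrix_algebra_adj[OF vna])
  qed (use assms(10) trA in \<open>auto simp: gns_representation_def\<close>)

  \<comment> \<open>Linear combinations of these vectors are dense in \<open>H\<close>. The action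
    of the matrix units, \<open>e\<close> and \<open>U\<close> is explicit on them or, for
    \<open>U\<close>, on those with unit matrix.\<close>
  define v where "v b m = \<pi> (tensor_op b m) \<Omega>" for b and m :: "complex ^ 'n ^ 'n"
  define S where "S = (\<lambda>b. v b (mat 1)) ` alg B"
  define HF where "HF = cyclic_space (\<pi> ` alg F) \<Omega>"
  have HF: "HF = closure S"
    by (simp add: HF_def cyclic_space_def S_def v_def assms(7) image_image)

  have v_linear: "clinear_on UNIV (v b)" if "b \<in> alg B" for b
    using that by (simp add: clinear_on_def v_def tensor_op_add_right tensor_op_scaleC_right
        rep_add rep_scaleC mem blinfun.add_left scaleC_blinfun.rep_eq)
  have v_add: "v (b + c) m = v b m + v c m" if "b \<in> alg B" "c \<in> alg B" for b c m
    using that by (simp add: v_def tensor_op_add_left rep_add mem blinfun.add_left)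
  have v_scaleC: "v (z *\<^sub>C b) m = z *\<^sub>C v b m" if "b \<in> alg B" for z b m
    using that by (simp add: v_def tensor_op_scaleC_left rep_scaleC mem scaleC_blinfun.rep_eq)
  have tensor_v: "\<pi> (tensor_op c k) (v b m) = v (c o\<^sub>L b) (k ** m)" if "b \<in> alg B" "c \<in> alg B" for b c k m
    using that rep_compose[OF mem mem, of c b k m] by (simp add: v_def tensor_op_compose ops)
  have v_cinner: "cinner (v c (mat 1)) (v b m) = tr B (adj c o\<^sub>L b) * (trace m / of_nat CARD('n))"
    if "b \<in> alg B" "c \<in> alg B" for b c m
    using that by (simp add: v_def rep_cinner mem adj_tensor_op ops conj_transpose_mat
        tensor_op_compose adj_bounded_ops vna_adj[OF vna] vna_compose[OF vna] assms(4))

  have "csubspace S"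
    unfolding csubspace_def
  proof (intro conjI ballI allI)
    have "0 *\<^sub>C id_blinfun \<in> alg B"
      using vna vna_id vna_scaleC by blast
    moreover have "v (0 *\<^sub>C id_blinfun) (mat 1) = 0"
      using vna_id[OF vna] by (simp add: v_scaleC)
    ultimately show "0 \<in> S"
      unfolding S_def by (metis image_eqI)
  next
    fix x y assume "x \<in> S" "y \<in> S"
    then show "x + y \<in> S"
      by (auto simp: S_def vna_add[OF vna] simp flip: v_add)
  next
    fix c x assume "x \<in> S"
    then show "c *\<^sub>C x \<in> S"
      by (auto simp: S_def vna_scaleC[OF vna] simp flip: v_scaleC)
  qed
  then have sub: "csubspace HF" and closed: "closed HF"
    by (simp_all add: HF csubspace_closure)

  define e where "e = jones_projection (\<pi> ` alg F) \<Omega>"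
  \<comment> \<open>The Jones projection implements the conditional expectation of A onto B
    \<otimes> 1, which averages the matrix part by the normalized trace. By \<open>v_cinner\<close>
    the remainder is orthogonal to F\<Omega>.\<close>
  have e_v: "e (v b m) = (trace m / of_nat CARD('n)) *\<^sub>C v b (mat 1)" if b: "b \<in> alg B" for b m
  proof (rule orthogonal_decomposition_unique[OF sub])
    show "e (v b m) \<in> HF" "v b m - e (v b m) \<in> ocompl HF"
      unfolding e_def jones_projection_def HF_def[symmetric]
      by (rule proj_mem[OF sub closed] diff_proj_mem[OF sub closed])+
    show "(trace m / of_nat CARD('n)) *\<^sub>C v b (mat 1) \<in> HF"
      using b closure_subset[of S] sub by (auto simp: HF S_def intro!: csubspace_scaleC)
    have "cinner (v c (mat 1)) (v b m - (trace m / of_nat CARD('n)) *\<^sub>C v b (mat 1)) = 0"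
      if "c \<in> alg B" for c
      using b that by (simp add: cinner_diff_right cinner_scaleC_right v_cinner trace_I)
    then show "v b m - (trace m / of_nat CARD('n)) *\<^sub>C v b (mat 1) \<in> ocompl HF"
      unfolding HF ocompl_closure by (auto simp: ocompl_def S_def)
  qed

  \<comment> \<open>The trace condition concerns plain sums of \<open>a e b\<close>, so the factor n
    is absorbed into the left matrix unit.\<close>
  define a where "a p = \<pi> (tensor_op id_blinfun (of_nat CARD('n) *\<^sub>C matrix_unit (fst p) (snd p)))"
    for p :: "'n \<times> 'n"
  define a' where "a' p = \<pi> (tensor_op id_blinfun (matrix_unit (snd p) (fst p)))"
    for p :: "'n \<times> 'n"
  have a_mem: "a p \<in> \<pi> ` alg A" "a' p \<in> \<pi> ` alg A" for p
    using vna_id[OF vna] mem by (auto simp: a_def a'_def)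
  have basis_v: "(\<Sum>p\<in>UNIV. a p o\<^sub>L e o\<^sub>L a' p) (v b m) = v b m" if b: "b \<in> alg B" for b m
  proof -
    have a_v: "a (i, j) (z *\<^sub>C v b (mat 1)) = (z * of_nat CARD('n)) *\<^sub>C v b (matrix_unit i j)" for i j z
    proof -
      have "a (i, j) (z *\<^sub>C v b (mat 1)) = z *\<^sub>C v b (of_nat CARD('n) *\<^sub>C matrix_unit i j)"
        using tensor_v[OF b vna_id[OF vna], of "of_nat CARD('n) *\<^sub>C matrix_unit i j" "mat 1"]
          image_bounded_ops a_mem(1)[of "(i, j)"]
        by (auto simp: a_def compose_id bounded_ops_def)
      also have "\<dots> = z *\<^sub>C of_nat CARD('n) *\<^sub>C v b (matrix_unit i j)"
        using v_linear[OF b] by (simp add: clinear_on_def)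
      finally show ?thesis
        by (simp add: scaleC_scaleC)
    qed
    \<comment> \<open>For p = (i, j), the right factor turns \<open>m\<close> into a matrix whose
      trace is the entry \<open>m_ij\<close>, \<open>e\<close> extracts this entry divided by n, and
      the left factor puts it back in place (i, j).\<close>
    have "(a p o\<^sub>L e o\<^sub>L a' p) (v b m) = (m $ fst p $ snd p) *\<^sub>C v b (matrix_unit (fst p) (snd p))" for p
      using b tensor_v[OF b vna_id[OF vna], of "matrix_unit (snd p) (fst p)" m]
        a_v[of "fst p" "snd p"]
      by (simp add: a'_def compose_id e_v trace_matrix_unit_mult)
    then have "(\<Sum>p\<in>UNIV. a p o\<^sub>L e o\<^sub>L a' p) (v b m)
        = (\<Sum>i\<in>UNIV. \<Sum>j\<in>UNIV. (m $ i $ j) *\<^sub>C v b (matrix_unit i j))"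
      by (simp add: blinfun.sum_left sum.cartesian_product split_def)
    then show ?thesis
      by (simp add: clinear_matrix_expansion[OF v_linear[OF b], of m])
  qed
  have basis_dense: "(\<Sum>p\<in>UNIV. a p o\<^sub>L e o\<^sub>L a' p) (\<pi> x \<Omega>) = \<pi> x \<Omega>" if x: "x \<in> alg A" for x
    using von_neumann_algebra_nonempty[OF vna] x[unfolded assms(2)]
  proof (induction rule: matrix_algebra_induct)
    case (tensor b m)
    then show ?case using basis_v by (simp add: v_def)
  next
    case (add x y)
    then show ?case by (simp add: rep_add assms(2) blinfun.add_left blinfun.add_right)
  next
    case (scaleC c x)
    have "e \<in> bounded_ops"
      unfolding e_def jones_projection_def HF_def[symmetric] by (rule proj_bounded_ops[OF sub closed])
    then have "(\<Sum>p\<in>UNIV. a p o\<^sub>L e o\<^sub>L a' p) (c *\<^sub>C z) = c *\<^sub>C (\<Sum>p\<in>UNIV. a p o\<^sub>L e o\<^sub>L a' p) z" for z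
      using subsetD[OF image_bounded_ops a_mem(1)] subsetD[OF image_bounded_ops a_mem(2)]
      by (simp add: blinfun.sum_left bounded_ops_def scaleC_sum_right)
    with scaleC show ?case by (simp add: rep_scaleC assms(2) scaleC_blinfun.rep_eq)
  qed
  have "(\<Sum>p\<in>UNIV. a p o\<^sub>L e o\<^sub>L a' p) x = x" for x
    by (rule eq_on_dense[OF dense, where x = x and g = "\<lambda>x. x"])
      (auto simp: basis_dense intro!: linear_continuous_on blinfun.bounded_linear_right)
  then have basis: "(\<Sum>p\<in>UNIV. a p o\<^sub>L e o\<^sub>L a' p) = id_blinfun"
    by (intro blinfun_eqI) simp

  \<comment> \<open>\<open>canonical_trace\<close> speaks of sums over initial segments of the
    naturals, hence the enumeration of the index pairs.\<close>
  obtain h and K :: nat where h: "bij_betw h {..<K} (UNIV :: ('n \<times> 'n) set)"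
    using ex_bij_betw_nat_finite[of "UNIV :: ('n \<times> 'n) set"] by (auto simp: atLeast0LessThan)
  have basis_nat: "(\<Sum>i<K. a (h i) o\<^sub>L e o\<^sub>L a' (h i)) = id_blinfun"
    using sum.reindex_bij_betw[OF h, of "\<lambda>p. a p o\<^sub>L e o\<^sub>L a' p"] basis by simp
  have "positive_op (id_blinfun :: 'h \<Rightarrow>\<^sub>L 'h)"
    by (simp add: positive_op_def cinner_norm)
  with assms(11)[unfolded canonical_trace_def, THEN conjunct2, THEN spec[of _ K],
      THEN spec[of _ "\<lambda>i. a (h i)"], THEN spec[of _ "\<lambda>i. a' (h i)"], folded e_def]
  have "\<mu>bar id_blinfun < \<infinity>"
    by (simp add: a_mem basis_nat)
  then have fin: "\<mu>bar (proj (ocompl HF)) < \<infinity>"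
    using assms(11) sub unfolding HF_def canonical_trace_def by (blast intro: finite_weight_proj_ocompl)

  define U where "U = evolution A \<pi> \<Omega>"
  have "unitary_op U \<and> (\<forall>a\<in>alg A. U (\<pi> a \<Omega>) = \<pi> (dyn A a) \<Omega>)"
    unfolding U_def evolution_def by (rule theI'[OF evolution_exists[OF assms(5) inv]])
  then have U: "unitary_op U" and U_v: "\<And>b. b \<in> alg B \<Longrightarrow> U (v b (mat 1)) = v (dyn B b) (mat 1)"
    by (simp_all add: v_def mem assms(6))
  \<comment> \<open>On F\<Omega> the unitary acts through \<beta>, which maps B onto B; the image is
    therefore all of \<open>S\<close>.\<close>
  have "blinfun_apply U ` S = (\<lambda>b. v b (mat 1)) ` dyn B ` alg B"
    by (simp add: S_def image_image U_v)
  then have "blinfun_apply U ` ocompl HF = ocompl HF"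
    unfolding HF ocompl_closure by (intro unitary_image_ocompl[OF U]) (simp add: S_def \<beta>)

  moreover have "right_submodule (\<pi> ` alg A) (\<pi> ` alg F) \<Omega> (ocompl HF)"
    unfolding HF_def
  proof (rule right_submodule_ocompl)
    show "alg F \<subseteq> alg A" using mem by (auto simp: assms(7))
    show "a o\<^sub>L b \<in> alg F" if "a \<in> alg F" "b \<in> alg F" for a b
      using that by (auto simp: assms(7) tensor_op_compose ops vna_compose[OF vna])
    show "adj a \<in> alg F" if "a \<in> alg F" for a
      using that by (auto simp: assms(7) adj_tensor_op ops vna_adj[OF vna] conj_transpose_mat)
  qed
  ultimately show ?thesis
    unfolding relative_discrete_spectrum_def using fin
    by (intro discrete_part_eq_ocompl) (simp add: finite_module_def HF_def U_def)
qed

end
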